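(* Consider the model $y_{t+h}=\langle\theta_h,\Upsilon_t\rangle+u_{h,t}$ with $\Upsilon_t=\begin{bmatrix}\mathbf w_t\\ X_t\end{bmatrix}$, $\theta_h=\begin{bmatrix}\alpha_h\\ \beta_h\end{bmatrix}$, and the estimator $\hat\theta_h=\widehat C_{\Upsilon\Upsilon,\mathrm K_\tau}^{-1}\widehat C_{\Upsilon y}$ defined in the context. Suppose: (1) $\langle x,\theta_h\rangle=0$ for all $x\in\ker C_{\Upsilon\Upsilon}$; (2) (i) the model holds with $\mathbb E[u_{h,t}\Upsilon_t]=0$; (ii) $\{\Upsilon_t\}$, $\{u_{h,t}\}$ and $\{u_{h,t}\Upsilon_t\}$ are stationary and $L^4$-$m$-approximable; (iii) $\|\widehat C_{\Upsilon u}\|=O_p(T^{-1/2})$, $\|\widehat C_{\Upsilon\Upsilon}-C_{\Upsilon\Upsilon}\|_{op}=O_p(T^{-1/2})$ and $\|\widehat\Gamma_{11}^{-1}-\Gamma_{11}^{-1}\|_{op}=O_p(T^{-1/2})$; (3) for a generic constant $C>0$ (possibly different in each occurrence) and all $j\ge1$: (i) $\lambda_j^2\le Cj^{-\rho}$ and $\lambda_j^2-\lambda_{j+1}^2\ge Cj^{-\rho-1}$ for some $\rho>2$; (ii) $|\langle\beta_h,v_j\rangle|\le Cj^{-\varsigma}$ for some $\varsigma>1/2$. If $T\tau^{1+4/\rho}\to\infty$ as $T\to\infty$, then $$\|\hat\theta_h-\theta_h\|=O_p\big(T^{-1/2}\tau^{-1/2-2/\rho}+\tau^{(2\varsigma-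1)/2\rho}\big).$$
   Context: $\mathcal H=L^2[0,1]$ and $\widetilde{\mathcal H}=\mathbb R^m\times\mathcal H$ is the product Hilbert space whose inner product is the sum of those of $\mathbb R^m$ and $\mathcal H$; $\langle\cdot,\cdot\rangle$, $\|\cdot\|$ denote inner product and norm in whichever space is relevant and $\|\cdot\|_{op}$ is the operator norm. $a\otimes b(\cdot)=\langle a,\cdot\rangle b$. Operators on $\widetilde{\mathcal H}$ are written as $2\times2$ operator matrices. $h$ is a fixed horizon; $y_{t+h}\in\mathbb R$, $\mathbf w_t\in\mathbb R^m$, $X_t\in\mathcal H$ have mean zero; $\alpha_h\in\mathbb R^m$, $\beta_h\in\mathcal H$. Covariances: $C_{\Upsilon\Upsilon}=\mathbb E[\Upsilon_t\otimes\Upsilon_t]$, $\widehat C_{\Upsilon\Upsilon}=T^{-1}\sum_{t=1}^T\Upsilon_t\otimes\Upsilon_t$, $\widehat C_{\Upsilon y}=T^{-1}\sum_{t=1}^Ty_{t+h}\Upsilon_t$, $\widehat C_{\Upsilon u}=T^{-1}\sum_{t=1}^Tu_{h,t}\Upsilon_t$. Write $C_{\Upsilon\Upsilon}=\begin{bmatrix}\Gamma_{11}&\Gamma_{12}\\ \Gamma_{21}&\Gamma_{22}\end{bmatrix}$, $\widehat C_{\Upsilon\Upsilon}=\begin{bmatrix}\widehat\Gamma_{11}&\widehat\Gamma_{12}\\ \widehat\Gamma_{21}&\widehat\Gamma_{22}\end{bmatrix}$, where $\Gamma_{ij}=\mathbb E[g_{jt}\otimes g_{it}]$, $\widehat\Gamma_{ij}=T^{-1}\sum_{t=1}^Tg_{jt}\otimes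 g_{it}$, $g_{1t}=\mathbf w_t$, $g_{2t}=X_t$. $\Gamma_{11}$ is assumed invertible. Schur complements: $\mathrm S=\Gamma_{22}-\Gamma_{21}\Gamma_{11}^{-1}\Gamma_{12}$ and $\widehat{\mathrm S}=\widehat\Gamma_{22}-\widehat\Gamma_{21}\widehat\Gamma_{11}^{-1}\widehat\Gamma_{12}$, with spectral decompositions $\mathrm S=\sum_j\lambda_jv_j\otimes v_j$, $\widehat{\mathrm S}=\sum_j\hat\lambda_j\hat v_j\otimes\hat v_j$ ($\lambda_1\ge\lambda_2\ge\dots\ge0$, $\hat\lambda_1\ge\hat\lambda_2\ge\dots\ge0$, orthonormal eigenvectors). Regularization: $\tau=\tau(T)>0$ with $\tau\to0$ as $T\to\infty$, $\mathrm K_\tau=\max\{j:\hat\lambda_j^2\ge\tau\}$, $\widehat{\mathrm S}_{\mathrm K_\tau}^{-1}=\sum_{j=1}^{\mathrm K_\tau}\hat\lambda_j^{-1}\hat v_j\otimes\hat v_j$, and $$\widehat C_{\Upsilon\Upsilon,\mathrm K_\tau}^{-1}=\begin{bmatrix}\widehat\Gamma_{11}^{-1}+\widehat\Gamma_{11}^{-1}\widehat\Gamma_{12}\widehat{\mathrm S}_{\mathrm K_\tau}^{-1}\widehat\Gamma_{21}\widehat\Gamma_{11}^{-1}&-\widehat\Gamma_{11}^{-1}\widehat\Gamma_{12}\widehat{\mathrm S}_{\mathrm K_\tau}^{-1}\\ -\widehat{\mathrm S}_{\mathrm K_\tau}^{-1}\widehat\Gamma_{21}\widehat\Gamma_{11}^{-1}&\widehat{\mathrm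 S}_{\mathrm K_\tau}^{-1}\end{bmatrix}.$$ $L^p$-$m$-approximability: a sequence $\{h_t\}$ in a separable Hilbert space is $L^p$-$m$-approximable if $h_t=f(e_t,e_{t-1},\dots)$ for a measurable $f$ and i.i.d. $\{e_t\}$, and for some $\delta\in(0,1)$: $\mathbb E[h_t]=0$, $\mathbb E\|h_t\|^{p+\delta}<\infty$ and $\sum_{m\ge1}(\mathbb E\|h_t-h_{t,m}\|^{p+\delta})^{1/\kappa}<\infty$ for some $\kappa>p+\delta$, where $h_{t,m}=f(e_t,\dots,e_{t-m+1},e^{(m)}_{t,t-m},e^{(m)}_{t,t-m-1},\dots)$ and $\{e^{(m)}_{t,k}\}$ are independent copies of $\{e_t\}$.
   Formalization: The formal statement adds that β_h = Σ_j ⟨β_h,v_j⟩v_j, i.e. β_h is orthogonal to ker S; condition (1) does not imply this and the claimed rate fails without it (automatic if the v_j form an orthonormal basis of H). *)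

theory Defs
  imports "HOL-Probability.Probability"
begin

section \<open>The Hilbert space \<open>L\<^sup>2[0,1]\<close>\<close>

text \<open>
  Square-integrable functions on the unit interval modulo equality almost everywhere. Using
  Borel instead of Lebesgue measurable representatives yields the same classes.
\<close>

definition lborel01 :: "real measure" where
  "lborel01 = restrict_space lborel {0..1}"

lemma space_lborel01: "space lborel01 = {0..1}"
  by (simp add: lborel01_def space_restrict_space)

lemma prob_space_lborel01: "prob_space lborel01"
  by (rule prob_spaceI) (simp add: lborel01_def space_restrict_space emeasure_restrict_space)

definition sq_integrable :: "(real \<Rightarrow> real) \<Rightarrow> bool" where
  "sq_integrable f \<longleftrightarrow> f \<in> borel_measurable lborel01 \<and> integrable lborel01 (\<lambda>x. (f x)\<^sup>2)"

lemma sq_integrable_measurable: "sq_integrable f \<Longrightarrow> f \<in> borel_measurable lborel01"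
  by (simp add: sq_integrable_def)

lemma sq_integrable_mult:
  assumes "sq_integrable f" "sq_integrable g"
  shows "integrable lborel01 (\<lambda>x. f x * g x)"
proof (rule Bochner_Integration.integrable_bound)
  show "integrable lborel01 (\<lambda>x. (f x)\<^sup>2 + (g x)\<^sup>2)"
    using assms by (simp add: sq_integrable_def)
  show "(\<lambda>x. f x * g x) \<in> borel_measurable lborel01"
    using assms[THEN sq_integrable_measurable] by measurable
  have "\<bar>a * b\<bar> \<le> a\<^sup>2 + b\<^sup>2" for a b :: real
    using sum_squares_bound[of "\<bar>a\<bar>" "\<bar>b\<bar>"] abs_ge_zero[of "a * b"]
    unfolding abs_mult power2_abs mult.assoc by linarith
  then show "AE x in lborel01. norm (f x * g x) \<le> norm ((f x)\<^sup>2 + (g x)\<^sup>2)"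
    by simp
qed

lemma sq_integrable_const [simp]: "sq_integrable (\<lambda>_. c)"
proof -
  interpret prob_space lborel01 by (rule prob_space_lborel01)
  show ?thesis by (simp add: sq_integrable_def)
qed

lemma sq_integrable_scale: "sq_integrable f \<Longrightarrow> sq_integrable (\<lambda>x. c * f x)"
  by (simp add: sq_integrable_def power_mult_distrib borel_measurable_times)

lemma sq_integrable_add:
  assumes "sq_integrable f" "sq_integrable g"
  shows "sq_integrable (\<lambda>x. f x + g x)"
proof -
  have "integrable lborel01 (\<lambda>x. (f x)\<^sup>2 + (g x)\<^sup>2 + 2 * (f x * g x))"
    using assms sq_integrable_mult[OF assms] by (simp add: sq_integrable_def)
  moreover have "(\<lambda>x. (f x)\<^sup>2 + (g x)\<^sup>2 + 2 * (f x * g x)) = (\<lambda>x. (f x + g x)\<^sup>2)"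
    by (simp add: fun_eq_iff power2_eq_square algebra_simps)
  moreover have "(\<lambda>x. f x + g x) \<in> borel_measurable lborel01"
    using assms[THEN sq_integrable_measurable] by measurable
  ultimately show ?thesis
    by (simp add: sq_integrable_def)
qed

lemma sq_integrable_uminus: "sq_integrable f \<Longrightarrow> sq_integrable (\<lambda>x. - f x)"
  by (simp add: sq_integrable_def)

lemma sq_integrable_diff: "sq_integrable f \<Longrightarrow> sq_integrable g \<Longrightarrow> sq_integrable (\<lambda>x. f x - g x)"
  using sq_integrable_add[of f "\<lambda>x. - g x"] sq_integrable_uminus[of g] by simp

lemma sq_integrable_bounded:
  assumes "f \<in> borel_measurable lborel01" and "\<And>x. \<bar>f x\<bar> \<le> B"
  shows "sq_integrable f"
  unfolding sq_integrable_def
proof (intro conjI assms)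
  interpret prob_space lborel01 by (rule prob_space_lborel01)
  show "integrable lborel01 (\<lambda>x. (f x)\<^sup>2)"
  proof (rule integrable_const_bound[where B="B\<^sup>2"])
    show "AE x in lborel01. norm ((f x)\<^sup>2) \<le> B\<^sup>2"
      using power_mono[OF assms(2) abs_ge_zero, of _ 2] by simp
  qed (use assms(1) in measurable)
qed

definition L2_rel :: "(real \<Rightarrow> real) \<Rightarrow> (real \<Rightarrow> real) \<Rightarrow> bool" where
  "L2_rel f g \<longleftrightarrow> sq_integrable f \<and> sq_integrable g \<and> (AE x in lborel01. f x = g x)"

lemma L2_rel_refl: "L2_rel f f \<longleftrightarrow> sq_integrable f"
  by (simp add: L2_rel_def)

quotient_type L2 = "real \<Rightarrow> real" / partial: L2_rel
proof (rule part_equivpI)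
  show "\<exists>f. L2_rel f f"
    by (rule exI[of _ "\<lambda>_. 0"]) (simp add: L2_rel_refl)
  show "symp L2_rel"
    by (auto simp: symp_def L2_rel_def)
  show "transp L2_rel"
  proof (rule transpI)
    fix f g h assume fg: "L2_rel f g" and gh: "L2_rel g h"
    then have "AE x in lborel01. f x = g x" "AE x in lborel01. g x = h x"
      by (auto simp: L2_rel_def)
    then have "AE x in lborel01. f x = h x" by eventually_elim simp
    with fg gh show "L2_rel f h" by (simp add: L2_rel_def)
  qed
qed

instantiation L2 :: real_inner
begin

lift_definition zero_L2 :: L2 is "\<lambda>_. 0"
  by (simp add: L2_rel_refl)

lift_definition plus_L2 :: "L2 \<Rightarrow> L2 \<Rightarrow> L2" is "\<lambda>f g x. f x + g x"
  by (auto simp: L2_rel_def sq_integrable_add elim: AE_mp)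

lift_definition uminus_L2 :: "L2 \<Rightarrow> L2" is "\<lambda>f x. - f x"
  by (auto simp: L2_rel_def sq_integrable_uminus)

lift_definition minus_L2 :: "L2 \<Rightarrow> L2 \<Rightarrow> L2" is "\<lambda>f g x. f x - g x"
  by (auto simp: L2_rel_def sq_integrable_diff elim: AE_mp)

lift_definition scaleR_L2 :: "real \<Rightarrow> L2 \<Rightarrow> L2" is "\<lambda>c f x. c * f x"
  by (auto simp: L2_rel_def sq_integrable_scale elim: AE_mp)

lift_definition inner_L2 :: "L2 \<Rightarrow> L2 \<Rightarrow> real" is "\<lambda>f g. \<integral>x. f x * g x \<partial>lborel01"
proof -
  fix f f' g g' assume f: "L2_rel f f'" and g: "L2_rel g g'"
  then have "AE x in lborel01. f x = f' x" "AE x in lborel01. g x = g' x"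
    by (auto simp: L2_rel_def)
  then have "AE x in lborel01. f x * g x = f' x * g' x"
    by eventually_elim simp
  then show "(\<integral>x. f x * g x \<partial>lborel01) = (\<integral>x. f' x * g' x \<partial>lborel01)"
    using f g by (intro integral_cong_AE) (auto simp: L2_rel_def sq_integrable_def)
qed

definition norm_L2 :: "L2 \<Rightarrow> real" where
  "norm_L2 x = sqrt (inner x x)"

definition sgn_L2 :: "L2 \<Rightarrow> L2" where
  "sgn_L2 x = inverse (norm x) *\<^sub>R x"

definition dist_L2 :: "L2 \<Rightarrow> L2 \<Rightarrow> real" where
  "dist_L2 x y = norm (x - y)"

definition uniformity_L2 :: "(L2 \<times> L2) filter" where
  "uniformity_L2 = (INF e\<in>{0<..}. principal {(x, y). dist x y < e})"

definition open_L2 :: "L2 set \<Rightarrow> bool" where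
  "open_L2 U \<longleftrightarrow> (\<forall>x\<in>U. \<forall>\<^sub>F (x', y) in uniformity. x' = x \<longrightarrow> y \<in> U)"

instance
proof
  fix x y z :: L2 and a b :: real
  show "x + y + z = x + (y + z)"
    by transfer (auto simp: L2_rel_def sq_integrable_add add.assoc)
  show "x + y = y + x"
    by transfer (auto simp: L2_rel_def sq_integrable_add add.commute)
  show "0 + x = x"
    by transfer (auto simp: L2_rel_def)
  show "- x + x = 0"
    by transfer (auto simp: L2_rel_def)
  show "x - y = x + - y"
    by transfer (auto simp: L2_rel_def sq_integrable_diff)
  show "a *\<^sub>R (x + y) = a *\<^sub>R x + a *\<^sub>R y"
    by transfer (auto simp: L2_rel_def sq_integrable_add sq_integrable_scale distrib_left)
  show "(a + b) *\<^sub>R x = a *\<^sub>R x + b *\<^sub>R x"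
    by transfer (auto simp: L2_rel_def sq_integrable_add sq_integrable_scale distrib_right)
  show "a *\<^sub>R b *\<^sub>R x = (a * b) *\<^sub>R x"
    by transfer (auto simp: L2_rel_def sq_integrable_scale mult.assoc)
  show "1 *\<^sub>R x = x"
    by transfer (auto simp: L2_rel_def)
  show "sgn x = inverse (norm x) *\<^sub>R x"
    by (rule sgn_L2_def)
  show "dist x y = norm (x - y)"
    by (rule dist_L2_def)
  show "inner x y = inner y x"
    by transfer (simp add: mult.commute)
  show "inner (x + y) z = inner x z + inner y z"
    by transfer (simp add: L2_rel_def distrib_right sq_integrable_mult)
  show "inner (a *\<^sub>R x) y = a * inner x y"
    by transfer (simp add: mult.assoc)
  show "0 \<le> inner x x"
    by transfer (simp add: integral_nonneg_AE)
  show "inner x x = 0 \<longleftrightarrow> x = 0"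
    by transfer
      (simp add: L2_rel_def sq_integrable_def integral_nonneg_eq_0_iff_AE flip: power2_eq_square)
  show "norm x = sqrt (inner x x)"
    by (rule norm_L2_def)
  show "uniformity = (INF e\<in>{0<..}. principal {(x, y :: L2). dist x y < e})"
    by (rule uniformity_L2_def)
  fix U :: "L2 set"
  show "open U = (\<forall>x\<in>U. \<forall>\<^sub>F (x', y) in uniformity. x' = x \<longrightarrow> y \<in> U)"
    by (rule open_L2_def)
qed

end


definition L2_of :: "(real \<Rightarrow> real) \<Rightarrow> L2" where
  "L2_of f = abs_L2 f"

lemma L2_of_cases:
  obtains f where "sq_integrable f" "x = L2_of f"
proof -
  have "L2_rel (rep_L2 x) (rep_L2 x)" "abs_L2 (rep_L2 x) = x"
    using Quotient_rep_reflp[OF Quotient_L2] Quotient_abs_rep[OF Quotient_L2] by auto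
  then show ?thesis
    using that[of "rep_L2 x"] by (simp add: L2_of_def L2_rel_refl)
qed

lemma L2_of_diff: "sq_integrable f \<Longrightarrow> sq_integrable g \<Longrightarrow> L2_of f - L2_of g = L2_of (\<lambda>x. f x - g x)"
  by (simp add: L2_of_def minus_L2.abs_eq L2_rel_refl)

lemma L2_of_add: "sq_integrable f \<Longrightarrow> sq_integrable g \<Longrightarrow> L2_of f + L2_of g = L2_of (\<lambda>x. f x + g x)"
  by (simp add: L2_of_def plus_L2.abs_eq L2_rel_refl)

lemma L2_of_scale: "sq_integrable f \<Longrightarrow> c *\<^sub>R L2_of f = L2_of (\<lambda>x. c * f x)"
  by (simp add: L2_of_def scaleR_L2.abs_eq L2_rel_refl)

lemma L2_of_zero: "L2_of (\<lambda>_. 0) = 0"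
  by (simp add: L2_of_def zero_L2_def)

lemma norm_L2_of: "sq_integrable f \<Longrightarrow> (norm (L2_of f))\<^sup>2 = (\<integral>x. (f x)\<^sup>2 \<partial>lborel01)"
  unfolding power2_norm_eq_inner
  by (simp add: L2_of_def inner_L2.abs_eq L2_rel_refl power2_eq_square)

lemma nn_norm_L2_of: "sq_integrable f \<Longrightarrow> (\<integral>\<^sup>+x. ennreal ((f x)\<^sup>2) \<partial>lborel01) = ennreal ((norm (L2_of f))\<^sup>2)"
  by (subst nn_integral_eq_integral) (auto simp: sq_integrable_def norm_L2_of)

lemma integral_abs_le_norm:
  assumes "sq_integrable f"
  shows "integrable lborel01 f" "(\<integral>x. \<bar>f x\<bar> \<partial>lborel01) \<le> norm (L2_of f)"
proof -
  interpret prob_space lborel01 by (rule prob_space_lborel01)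
  have f: "f \<in> borel_measurable lborel01" "integrable lborel01 (\<lambda>x. (f x)\<^sup>2)"
    using assms by (simp_all add: sq_integrable_def)
  show i: "integrable lborel01 f"
    by (rule square_integrable_imp_integrable[OF f])
  have "variance (\<lambda>x. \<bar>f x\<bar>) = (\<integral>x. \<bar>f x\<bar>\<^sup>2 \<partial>lborel01) - (\<integral>x. \<bar>f x\<bar> \<partial>lborel01)\<^sup>2"
    by (rule variance_eq) (use f i in simp_all)
  then have "(\<integral>x. \<bar>f x\<bar> \<partial>lborel01)\<^sup>2 \<le> (\<integral>x. \<bar>f x\<bar>\<^sup>2 \<partial>lborel01)"
    using variance_positive[of "\<lambda>x. \<bar>f x\<bar>"] by linarith
  then have "(\<integral>x. \<bar>f x\<bar> \<partial>lborel01)\<^sup>2 \<le> (norm (L2_of f))\<^sup>2"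
    using assms by (simp add: norm_L2_of)
  then show "(\<integral>x. \<bar>f x\<bar> \<partial>lborel01) \<le> norm (L2_of f)"
    by (rule power2_le_imp_le) simp
qed

instance L2 :: complete_space
proof
  fix X :: "nat \<Rightarrow> L2"
  assume C: "Cauchy X"
  have "\<exists>r. \<forall>n. (\<forall>m\<ge>r n. dist (X m) (X (r n)) < (1/2)^n) \<and> r n < r (Suc n)"
  proof (rule dependent_nat_choice)
    show "\<exists>x. \<forall>m\<ge>x. dist (X m) (X x) < (1/2)^0"
      using C[unfolded Cauchy_def, rule_format, of 1] by auto
    fix x n
    have "(0::real) < (1/2)^Suc n" by simp
    then obtain N where "\<And>m k. m \<ge> N \<Longrightarrow> k \<ge> N \<Longrightarrow> dist (X m) (X k) < (1/2)^Suc n"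
      using C unfolding Cauchy_def by blast
    then show "\<exists>y. (\<forall>m\<ge>y. dist (X m) (X y) < (1/2)^Suc n) \<and> x < y"
      by (intro exI[of _ "max N (Suc x)"]) auto
  qed
  then obtain r where r: "\<And>n m. m \<ge> r n \<Longrightarrow> dist (X m) (X (r n)) < (1/2)^n"
    and rmono: "strict_mono r"
    by (auto simp: strict_mono_Suc_iff)
  have "\<forall>n. \<exists>f. sq_integrable f \<and> X (r n) = L2_of f"
    using L2_of_cases by blast
  then obtain f where f: "\<And>n. sq_integrable (f n)" "\<And>n. X (r n) = L2_of (f n)"
    by metis
  have [measurable]: "\<And>n. f n \<in> borel_measurable lborel01"
    using f by (simp add: sq_integrable_def)
  have d: "norm (L2_of (\<lambda>x. f m x - f n x)) \<le> (1/2)^n" if "n \<le> m" for m n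
    using r[of n "r m"] strict_mono_less_eq[OF rmono] that
    by (simp add: f L2_of_diff[symmetric] dist_norm less_imp_le)
  have "AE x in lborel01. summable (\<lambda>n. norm (f (Suc n) x - f n x))"
  proof -
    have "(\<integral>\<^sup>+x. (\<Sum>n. ennreal \<bar>f (Suc n) x - f n x\<bar>) \<partial>lborel01)
        = (\<Sum>n. \<integral>\<^sup>+x. ennreal \<bar>f (Suc n) x - f n x\<bar> \<partial>lborel01)"
      by (rule nn_integral_suminf) measurable
    also have "\<dots> \<le> (\<Sum>n. ennreal ((1/2)^n))"
    proof (intro suminf_le)
      fix n
      have "(\<integral>\<^sup>+x. ennreal \<bar>f (Suc n) x - f n x\<bar> \<partial>lborel01)
          = ennreal (\<integral>x. \<bar>f (Suc n) x - f n x\<bar> \<partial>lborel01)"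
        using integral_abs_le_norm(1)[OF sq_integrable_diff[OF f(1)[of "Suc n"] f(1)[of n]]]
        by (intro nn_integral_eq_integral) auto
      also have "\<dots> \<le> ennreal ((1/2)^n)"
        using integral_abs_le_norm(2)[OF sq_integrable_diff[OF f(1)[of "Suc n"] f(1)[of n]]] d[of n "Suc n"]
        by (intro ennreal_leI) simp
      finally show "(\<integral>\<^sup>+x. ennreal \<bar>f (Suc n) x - f n x\<bar> \<partial>lborel01) \<le> ennreal ((1/2)^n)" .
    qed auto
    also have "(\<Sum>n. ennreal ((1/2)^n)) = ennreal (\<Sum>n. (1/2)^n)"
      by (rule suminf_ennreal2) (auto intro: summable_geometric)
    also have "\<dots> < \<infinity>"
      by simp
    finally have "AE x in lborel01. (\<Sum>n. ennreal \<bar>f (Suc n) x - f n x\<bar>) \<noteq> \<infinity>"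
      by (intro nn_integral_PInf_AE) auto
    then show ?thesis
      by eventually_elim (rule summable_suminf_not_top, simp_all)
  qed
  then have conv: "AE x in lborel01. (\<lambda>n. f n x) \<longlonglongrightarrow> lim (\<lambda>n. f n x)"
  proof eventually_elim
    case (elim x)
    then have "summable (\<lambda>n. f (Suc n) x - f n x)"
      by (rule summable_norm_cancel)
    then obtain s where "(\<lambda>n. \<Sum>i<n. f (Suc i) x - f i x) \<longlonglongrightarrow> s"
      by (auto simp: summable_def sums_def)
    then have "(\<lambda>n. (f n x - f 0 x) + f 0 x) \<longlonglongrightarrow> s + f 0 x"
      by (intro tendsto_add) (simp_all add: sum_lessThan_telescope[of "\<lambda>i. f i x"])
    then have "(\<lambda>n. f n x) \<longlonglongrightarrow> s + f 0 x"
      by simp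
    then show ?case
      by (simp add: limI)
  qed
  define g where "g = (\<lambda>x. lim (\<lambda>n. f n x))"
  have [measurable]: "g \<in> borel_measurable lborel01"
    unfolding g_def by measurable
  have bound: "(\<integral>\<^sup>+x. ennreal ((g x - f n x)\<^sup>2) \<partial>lborel01) \<le> ennreal (((1/2)^n)\<^sup>2)" for n
  proof -
    have "(\<integral>\<^sup>+x. ennreal ((g x - f n x)\<^sup>2) \<partial>lborel01)
        = (\<integral>\<^sup>+x. liminf (\<lambda>m. ennreal ((f m x - f n x)\<^sup>2)) \<partial>lborel01)"
    proof (rule nn_integral_cong_AE)
      show "AE x in lborel01. ennreal ((g x - f n x)\<^sup>2) = liminf (\<lambda>m. ennreal ((f m x - f n x)\<^sup>2))"
        using conv
      proof eventually_elim
        case (elim x)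
        then have "(\<lambda>m. ennreal ((f m x - f n x)\<^sup>2)) \<longlonglongrightarrow> ennreal ((g x - f n x)\<^sup>2)"
          unfolding g_def by (intro tendsto_ennrealI tendsto_intros)
        then show ?case
          by (rule lim_imp_Liminf[symmetric, rotated]) simp
      qed
    qed
    also have "\<dots> \<le> liminf (\<lambda>m. \<integral>\<^sup>+x. ennreal ((f m x - f n x)\<^sup>2) \<partial>lborel01)"
      by (rule nn_integral_liminf) measurable
    also have "\<dots> \<le> limsup (\<lambda>m. \<integral>\<^sup>+x. ennreal ((f m x - f n x)\<^sup>2) \<partial>lborel01)"
      by (rule Liminf_le_Limsup) simp
    also have "\<dots> \<le> ennreal (((1/2)^n)\<^sup>2)"
    proof (rule Limsup_bounded)
      show "\<forall>\<^sub>F m in sequentially. (\<integral>\<^sup>+x. ennreal ((f m x - f n x)\<^sup>2) \<partial>lborel01) \<le> ennreal (((1/2)^n)\<^sup>2)"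
        using eventually_ge_at_top[of n]
      proof eventually_elim
        case (elim m)
        show ?case
          unfolding nn_norm_L2_of[OF sq_integrable_diff[OF f(1)[of m] f(1)[of n]]]
          by (intro ennreal_leI power_mono d elim norm_ge_zero)
      qed
    qed
    finally show ?thesis .
  qed
  have gd: "sq_integrable (\<lambda>x. g x - f n x)" for n
    unfolding sq_integrable_def
  proof
    have "(\<integral>\<^sup>+x. ennreal ((g x - f n x)\<^sup>2) \<partial>lborel01) < \<infinity>"
      using bound[of n] by (rule le_less_trans) simp
    then show "integrable lborel01 (\<lambda>x. (g x - f n x)\<^sup>2)"
      by (intro integrableI_bounded) simp_all
  qed measurable
  have g: "sq_integrable g"
    using sq_integrable_add[OF gd[of 0] f(1)[of 0]] by simp
  have "norm (L2_of (f n) - L2_of g) \<le> (1/2)^n" for n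
  proof -
    have "ennreal ((norm (L2_of (\<lambda>x. g x - f n x)))\<^sup>2) \<le> ennreal (((1/2)^n)\<^sup>2)"
      using bound[of n] by (simp add: nn_norm_L2_of[OF gd])
    then have "(norm (L2_of (\<lambda>x. g x - f n x)))\<^sup>2 \<le> ((1/2)^n)\<^sup>2"
      by (subst (asm) ennreal_le_iff) auto
    then have "norm (L2_of (\<lambda>x. g x - f n x)) \<le> (1/2)^n"
      by (rule power2_le_imp_le) simp
    then show ?thesis
      unfolding L2_of_diff[OF g f(1), symmetric] by (subst norm_minus_commute)
  qed
  then have "(\<lambda>n. norm (L2_of (f n) - L2_of g)) \<longlonglongrightarrow> 0"
    by (intro tendsto_sandwich[OF _ _ tendsto_const LIMSEQ_power_zero[of "1/2::real"]]) auto
  then have "(X \<circ> r) \<longlonglongrightarrow> L2_of g"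
    unfolding o_def f(2) tendsto_norm_zero_iff LIM_zero_iff .
  then show "convergent X"
    using Cauchy_converges_subseq[OF C rmono] convergentI by blast
qed

instance L2 :: banach ..

lemma closure_add_closed:
  fixes D :: "'a::real_normed_vector set"
  assumes "\<And>x y. x \<in> D \<Longrightarrow> y \<in> D \<Longrightarrow> x + y \<in> D" "x \<in> closure D" "y \<in> closure D"
  shows "x + y \<in> closure D"
proof -
  obtain s t where "\<And>n. s n \<in> D" "s \<longlonglongrightarrow> x" "\<And>n. t n \<in> D" "t \<longlonglongrightarrow> y"
    using assms(2,3) by (metis closure_sequential)
  then show ?thesis
    unfolding closure_sequential
    by (intro exI[of _ "\<lambda>n. s n + t n"]) (auto intro: tendsto_add assms(1))
qed

lemma closure_scaleR_closed:
  fixes D :: "'a::real_normed_vector set"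
  assumes "\<And>c x. c \<in> \<rat> \<Longrightarrow> x \<in> D \<Longrightarrow> c *\<^sub>R x \<in> D" "x \<in> closure D"
  shows "c *\<^sub>R x \<in> closure D"
proof -
  obtain s where s: "\<And>n. s n \<in> D" "s \<longlonglongrightarrow> x"
    using assms(2) by (metis closure_sequential)
  have "c \<in> closure \<rat>"
    by (simp add: Rats_closure_real)
  then obtain t where t: "\<And>n. t n \<in> \<rat>" "t \<longlonglongrightarrow> c"
    by (metis closure_sequential)
  from s t show ?thesis
    unfolding closure_sequential
    by (intro exI[of _ "\<lambda>n. t n *\<^sub>R s n"]) (auto intro: tendsto_scaleR assms(1))
qed

definition L2_steps :: "L2 set" where
  "L2_steps = range (\<lambda>xs :: (rat \<times> rat) list.
     \<Sum>(c, q)\<leftarrow>xs. real_of_rat c *\<^sub>R L2_of (indicator {..real_of_rat q}))"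

lemma countable_L2_steps: "countable L2_steps"
  unfolding L2_steps_def by simp

lemma L2_steps_add: "x \<in> L2_steps \<Longrightarrow> y \<in> L2_steps \<Longrightarrow> x + y \<in> L2_steps"
  unfolding L2_steps_def by (force simp flip: sum_list_append map_append)

lemma L2_steps_scaleR:
  assumes "c \<in> \<rat>" "x \<in> L2_steps"
  shows "c *\<^sub>R x \<in> L2_steps"
proof -
  obtain r where c: "c = real_of_rat r"
    using assms(1) by (auto elim: Rats_cases)
  obtain xs :: "(rat \<times> rat) list"
    where x: "x = (\<Sum>(c, q)\<leftarrow>xs. real_of_rat c *\<^sub>R L2_of (indicator {..real_of_rat q}))"
    using assms(2) by (auto simp: L2_steps_def)
  have "c *\<^sub>R x = (\<Sum>(c, q)\<leftarrow>map (\<lambda>(a, q). (r * a, q)) xs.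
      real_of_rat c *\<^sub>R L2_of (indicator {..real_of_rat q}))"
    unfolding x c by (induction xs) (auto simp: scaleR_add_right of_rat_mult)
  then show ?thesis
    unfolding L2_steps_def by blast
qed

lemma sq_integrable_indicator: "A \<in> sets borel \<Longrightarrow> sq_integrable (indicator A)"
  by (rule sq_integrable_bounded[where B=1]) (auto simp: lborel01_def indicator_def intro!: measurable_restrict_space1)

lemma L2_of_tendsto:
  assumes s: "\<And>n. sq_integrable (s n)" and f: "sq_integrable f"
    and lim: "AE x in lborel01. (\<lambda>n. s n x) \<longlonglongrightarrow> f x"
    and bnd: "\<And>n x. x \<in> {0..1} \<Longrightarrow> \<bar>s n x - f x\<bar> \<le> w x" and w: "sq_integrable w"
  shows "(\<lambda>n. L2_of (s n)) \<longlonglongrightarrow> L2_of f"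
proof -
  have [measurable]: "\<And>n. s n \<in> borel_measurable lborel01" "f \<in> borel_measurable lborel01"
    using s f by (auto simp: sq_integrable_def)
  have "(\<lambda>n. \<integral>x. (s n x - f x)\<^sup>2 \<partial>lborel01) \<longlonglongrightarrow> (\<integral>x. 0 \<partial>lborel01)"
  proof (rule integral_dominated_convergence[where w="\<lambda>x. (w x)\<^sup>2"])
    show "AE x in lborel01. (\<lambda>n. (s n x - f x)\<^sup>2) \<longlonglongrightarrow> 0"
      using lim
    proof eventually_elim
      case (elim x)
      then have "(\<lambda>n. (s n x - f x)\<^sup>2) \<longlonglongrightarrow> (f x - f x)\<^sup>2"
        by (intro tendsto_intros)
      then show ?case by simp
    qed
    show "AE x in lborel01. norm ((s n x - f x)\<^sup>2) \<le> (w x)\<^sup>2" for n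
    proof (rule AE_I2)
      fix x assume "x \<in> space lborel01"
      then have "\<bar>s n x - f x\<bar> \<le> w x"
        using bnd by (simp add: space_lborel01)
      then show "norm ((s n x - f x)\<^sup>2) \<le> (w x)\<^sup>2"
        by (metis abs_ge_zero norm_power power_mono real_norm_def)
    qed
  qed (use w in \<open>auto simp: sq_integrable_def\<close>)
  then have "(\<lambda>n. (norm (L2_of (s n) - L2_of f))\<^sup>2) \<longlonglongrightarrow> 0"
    by (simp add: L2_of_diff s f norm_L2_of sq_integrable_diff)
  then have "(\<lambda>n. sqrt ((norm (L2_of (s n) - L2_of f))\<^sup>2)) \<longlonglongrightarrow> sqrt 0"
    by (rule tendsto_real_sqrt)
  then show ?thesis
    by (simp add: LIM_zero_iff tendsto_norm_zero_iff)
qed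

lemma L2_steps_atMost: "L2_of (indicator {..a}) \<in> closure L2_steps"
proof -
  have "\<exists>q. a < real_of_rat q \<and> real_of_rat q < a + 1 / Suc n" for n
    by (rule of_rat_dense) simp
  then obtain q where q: "\<And>n. a < real_of_rat (q n)" "\<And>n. real_of_rat (q n) < a + 1 / Suc n"
    by metis
  have q_lim: "(\<lambda>n. real_of_rat (q n)) \<longlonglongrightarrow> a"
  proof (rule tendsto_sandwich[of "\<lambda>_. a"])
    show "(\<lambda>n. a + 1 / Suc n) \<longlonglongrightarrow> a"
      using tendsto_add[OF tendsto_const[of a] LIMSEQ_inverse_real_of_nat]
      by (simp add: inverse_eq_divide)
  qed (use q in \<open>auto intro: less_imp_le eventuallyI\<close>)
  have "(\<lambda>n. L2_of (indicator {..real_of_rat (q n)})) \<longlonglongrightarrow> L2_of (indicator {..a})"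
  proof (rule L2_of_tendsto[where w="\<lambda>_. 1"])
    show "AE x in lborel01. (\<lambda>n. indicator {..real_of_rat (q n)} x :: real) \<longlonglongrightarrow> indicator {..a} x"
    proof (rule AE_I2)
      fix x
      show "(\<lambda>n. indicator {..real_of_rat (q n)} x :: real) \<longlonglongrightarrow> indicator {..a} x"
      proof (cases "x \<le> a")
        case True
        then have "x \<le> real_of_rat (q n)" for n
          using q(1)[of n] by simp
        with True show ?thesis by simp
      next
        case False
        then have "\<forall>\<^sub>F n in sequentially. real_of_rat (q n) < x"
          by (intro order_tendstoD(2)[OF q_lim]) simp
        then have "\<forall>\<^sub>F n in sequentially. indicator {..real_of_rat (q n)} x = (indicator {..a} x :: real)"
          by eventually_elim (use False in auto)
        then show ?thesis by (rule tendsto_eventually)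
      qed
    qed
  qed (auto intro: sq_integrable_indicator simp: indicator_def)
  moreover have "L2_of (indicator {..real_of_rat (q n)}) \<in> L2_steps" for n
    unfolding L2_steps_def by (rule range_eqI[of _ _ "[(1, q n)]"]) simp
  ultimately show ?thesis
    unfolding closure_sequential
    by (intro exI[of _ "\<lambda>n. L2_of (indicator {..real_of_rat (q n)})"]) auto
qed

lemma L2_steps_indicator:
  assumes "A \<in> sets (borel :: real measure)"
  shows "L2_of (indicator A) \<in> closure L2_steps"
proof -
  have add: "x + y \<in> closure L2_steps" if "x \<in> closure L2_steps" "y \<in> closure L2_steps" for x y
    using closure_add_closed[OF L2_steps_add] that by blast
  have scale: "c *\<^sub>R x \<in> closure L2_steps" if "x \<in> closure L2_steps" for c x
    using closure_scaleR_closed[OF L2_steps_scaleR] that by blast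
  have zero: "0 \<in> closure L2_steps"
    using scale[OF L2_steps_atMost, of 0 0] by simp
  have eq: "L2_of f = L2_of g" if "\<And>x. x \<in> {0..1} \<Longrightarrow> f x = g x" "sq_integrable f" "sq_integrable g" for f g
    unfolding L2_of_def using that
    by (intro Quotient_rel_abs[OF Quotient_L2]) (auto simp: L2_rel_def space_lborel01)
  have borel: "sets (borel :: real measure) = sigma_sets UNIV (range (\<lambda>a. {..a}))"
    by (simp add: borel_eq_atMost)
  have "Int_stable (range (\<lambda>a :: real. {..a}))"
    by (auto simp: Int_stable_def)
  moreover have "range (\<lambda>a :: real. {..a}) \<subseteq> Pow UNIV" by simp
  moreover have "A \<in> sigma_sets UNIV (range (\<lambda>a :: real. {..a}))"
    using assms by (simp add: borel)
  ultimately show ?thesis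
  proof (induction rule: sigma_sets_induct_disjoint)
    case (basic A)
    then show ?case using L2_steps_atMost by auto
  next
    case empty
    show ?case using zero by (simp add: L2_of_zero)
  next
    case (compl A)
    then have A: "A \<in> sets borel" by (simp add: borel)
    have "L2_of (indicator (UNIV - A)) = L2_of (\<lambda>x. indicator {..1} x + (-1) * indicator A x)"
    proof (rule eq)
      show "sq_integrable (indicator (UNIV - A))"
        using A by (intro sq_integrable_indicator) auto
      show "sq_integrable (\<lambda>x. indicator {..1} x + (-1) * indicator A x)"
        using A by (intro sq_integrable_add sq_integrable_scale sq_integrable_indicator) auto
    qed (auto simp: indicator_def)
    also have "\<dots> = L2_of (indicator {..1}) + (-1) *\<^sub>R L2_of (indicator A)"
      using A by (subst L2_of_scale, simp add: sq_integrable_indicator, subst L2_of_add)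
        (auto intro!: sq_integrable_indicator sq_integrable_uminus)
    finally have "L2_of (indicator (UNIV - A)) = L2_of (indicator {..1}) + (-1) *\<^sub>R L2_of (indicator A)" .
    then show ?case
      using add[OF L2_steps_atMost scale[OF compl.IH]] by metis
  next
    case (union B)
    then have B: "\<And>i. B i \<in> sets borel" by (auto simp: borel)
    have fin: "L2_of (indicator (\<Union>i<n. B i)) \<in> closure L2_steps" for n
    proof (induction n)
      case 0
      have eq0: "indicator (\<Union>i<0. B i) = (\<lambda>_. 0 :: real)"
        by (simp add: fun_eq_iff)
      show ?case
        unfolding eq0 L2_of_zero by (rule zero)
    next
      case (Suc n)
      have "B i \<inter> B n = {}" if "i < n" for i
        using union(1) that by (auto simp: disjoint_family_on_def)
      then have "indicator (\<Union>i<Suc n. B i) x = indicator (\<Union>i<n. B i) x + (indicator (B n) x :: real)" for x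
        by (fastforce simp: indicator_def less_Suc_eq)
      then have "indicator (\<Union>i<Suc n. B i) = (\<lambda>x. indicator (\<Union>i<n. B i) x + (indicator (B n) x :: real))"
        by (rule ext)
      moreover have "sq_integrable (indicator (\<Union>i<n. B i))" "sq_integrable (indicator (B n))"
        using B by (intro sq_integrable_indicator; auto)+
      ultimately have "L2_of (indicator (\<Union>i<Suc n. B i)) = L2_of (indicator (\<Union>i<n. B i)) + L2_of (indicator (B n))"
        by (simp only: L2_of_add)
      then show ?case
        using add[OF Suc.IH union.IH] by metis
    qed
    have "(\<lambda>n. L2_of (indicator (\<Union>i<n. B i))) \<longlonglongrightarrow> L2_of (indicator (\<Union>i. B i))"
    proof (rule L2_of_tendsto[where w="\<lambda>_. 1"])
      show "AE x in lborel01. (\<lambda>n. indicator (\<Union>i<n. B i) x :: real) \<longlonglongrightarrow> indicator (\<Union>i. B i) x"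
        by (intro AE_I2 LIMSEQ_indicator_UN)
      show "\<bar>indicator (\<Union>i<n. B i) x - indicator (\<Union>i. B i) x\<bar> \<le> (1 :: real)" for n x
        by (simp add: indicator_def)
    qed (use B in \<open>auto intro!: sq_integrable_indicator\<close>)
    then show ?case
      by (rule closed_sequentially[OF closed_closure fin])
  qed
qed

lemma closure_L2_steps: "closure L2_steps = UNIV"
proof -
  have add: "x + y \<in> closure L2_steps" if "x \<in> closure L2_steps" "y \<in> closure L2_steps" for x y
    using closure_add_closed[OF L2_steps_add] that by blast
  have scale: "c *\<^sub>R x \<in> closure L2_steps" if "x \<in> closure L2_steps" for c x
    using closure_scaleR_closed[OF L2_steps_scaleR] that by blast
  have "x \<in> closure L2_steps" for x
  proof -
    obtain f where f: "sq_integrable f" "x = L2_of f" by (rule L2_of_cases)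
    then have [measurable]: "f \<in> borel_measurable lborel01" by (simp add: sq_integrable_def)
    obtain s where s: "\<forall>i. simple_function lborel01 (s i)"
      "\<forall>x\<in>{0..1}. (\<lambda>i. s i x) \<longlonglongrightarrow> f x"
      "\<forall>i. \<forall>x\<in>{0..1}. \<bar>s i x\<bar> \<le> 2 * \<bar>f x\<bar>"
      using borel_measurable_implies_sequence_metric[of f lborel01 0]
      by (simp add: space_lborel01 dist_real_def) blast
    have s_sq_integrable: "sq_integrable (s i)" and s_cl: "L2_of (s i) \<in> closure L2_steps" for i
    proof -
      have fin: "finite (s i ` {0..1})"
        using simple_functionD(1)[OF s(1)[rule_format, of i]] by (simp add: space_lborel01)
      have meas: "s i -` {y} \<inter> {0..1} \<in> sets borel" for y
        using simple_functionD(2)[OF s(1)[rule_format, of i], of "{y}"]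
        by (simp add: lborel01_def space_restrict_space sets_restrict_space_iff)
      define h where "h Y x = (\<Sum>y\<in>Y. y * indicator (s i -` {y} \<inter> {0..1}) x)" for Y and x :: real
      have h: "sq_integrable (h Y) \<and> L2_of (h Y) \<in> closure L2_steps" if "finite Y" for Y
        using that
      proof (induction Y)
        case empty
        show ?case
          using scale[OF L2_steps_atMost, of 0 0] by (simp add: h_def[abs_def] L2_of_zero)
      next
        case (insert y Y)
        let ?k = "\<lambda>x. y * indicator (s i -` {y} \<inter> {0..1}) x"
        have k: "sq_integrable ?k" "L2_of ?k \<in> closure L2_steps"
          using sq_integrable_indicator[OF meas[of y]] L2_steps_indicator[OF meas[of y]]
          by (auto simp: L2_of_scale[symmetric] intro: sq_integrable_scale scale)
        have "h (insert y Y) = (\<lambda>x. ?k x + h Y x)"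
          by (intro ext) (simp only: h_def sum.insert[OF insert.hyps])
        then show ?case
          using insert.IH k by (auto simp: L2_of_add[symmetric] intro: sq_integrable_add add)
      qed
      have eq: "s i x = h (s i ` {0..1}) x" if "x \<in> {0..1}" for x
      proof -
        have "h (s i ` {0..1}) x = (\<Sum>y\<in>s i ` {0..1}. if y = s i x then y else 0)"
          unfolding h_def by (intro sum.cong) (use that in \<open>auto simp: indicator_def\<close>)
        also have "\<dots> = s i x" using fin that by simp
        finally show ?thesis by simp
      qed
      have hs: "sq_integrable (h (s i ` {0..1}))" and hc: "L2_of (h (s i ` {0..1})) \<in> closure L2_steps"
        using h[OF fin] by auto
      have [measurable]: "s i \<in> borel_measurable lborel01"
        by (rule borel_measurable_simple_function[OF s(1)[rule_format]])
      have ae: "AE x in lborel01. s i x = h (s i ` {0..1}) x"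
        by (rule AE_I2) (simp add: space_lborel01 eq)
      show s_sq_integrable: "sq_integrable (s i)"
        unfolding sq_integrable_def
      proof
        have "integrable lborel01 (\<lambda>x. (s i x)\<^sup>2) = integrable lborel01 (\<lambda>x. (h (s i ` {0..1}) x)\<^sup>2)"
          by (rule Bochner_Integration.integrable_cong) (auto simp: space_lborel01 eq)
        then show "integrable lborel01 (\<lambda>x. (s i x)\<^sup>2)"
          using hs by (simp add: sq_integrable_def)
      qed measurable
      have "L2_of (s i) = L2_of (h (s i ` {0..1}))"
        unfolding L2_of_def using s_sq_integrable hs ae
        by (intro Quotient_rel_abs[OF Quotient_L2]) (simp add: L2_rel_def)
      then show "L2_of (s i) \<in> closure L2_steps"
        using hc by simp
    qed
    have "(\<lambda>i. L2_of (s i)) \<longlonglongrightarrow> L2_of f"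
    proof (rule L2_of_tendsto[where w="\<lambda>x. 3 * \<bar>f x\<bar>"])
      show "AE x in lborel01. (\<lambda>i. s i x) \<longlonglongrightarrow> f x"
        by (rule AE_I2) (simp add: space_lborel01 s)
      show "\<bar>s n x - f x\<bar> \<le> 3 * \<bar>f x\<bar>" if "x \<in> {0..1}" for n x
        using s(3)[rule_format, OF that, of n] by linarith
      show "sq_integrable (\<lambda>x. 3 * \<bar>f x\<bar>)"
        using f(1) by (auto simp: sq_integrable_def power_mult_distrib)
    qed (use f s_sq_integrable in auto)
    then show ?thesis
      unfolding f(2) by (rule closed_sequentially[OF closed_closure s_cl])
  qed
  then show ?thesis by blast
qed

lemma countable_dense_imp_second_countable:
  fixes D :: "'a::metric_space set"
  assumes "countable D" "closure D = UNIV"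
  shows "\<exists>B :: 'a set set. countable B \<and> open = generate_topology B"
proof -
  define B where "B = (\<lambda>(d, q). ball d (real_of_rat q)) ` (D \<times> UNIV)"
  have "topological_basis B"
  proof (rule topological_basisI)
    show "open U" if "U \<in> B" for U
      using that by (auto simp: B_def)
    fix U :: "'a set" and x assume "open U" "x \<in> U"
    then obtain e where e: "e > 0" "ball x e \<subseteq> U"
      by (meson open_contains_ball)
    obtain d where d: "d \<in> D" "dist d x < e / 2"
      using closure_approachable[of x D] assms(2) e(1) by (metis UNIV_I half_gt_zero)
    obtain q where q: "dist d x < real_of_rat q" "real_of_rat q < e / 2"
      using of_rat_dense[OF d(2)] by blast
    have "ball d (real_of_rat q) \<subseteq> ball x e"
    proof
      fix y assume "y \<in> ball d (real_of_rat q)"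
      then show "y \<in> ball x e"
        using dist_triangle[of x y d] d(2) q(2) by (simp add: dist_commute)
    qed
    moreover have "ball d (real_of_rat q) \<in> B"
      unfolding B_def using d(1) by (auto intro!: image_eqI[of _ _ "(d, q)"])
    ultimately show "\<exists>B'\<in>B. x \<in> B' \<and> B' \<subseteq> U"
      using e(2) q(1) by (intro bexI[of _ "ball d (real_of_rat q)"]) auto
  qed
  moreover have "countable B"
    using assms(1) by (simp add: B_def)
  ultimately show ?thesis
    using topological_basis_imp_subbasis by blast
qed

instance L2 :: second_countable_topology
  by standard (rule countable_dense_imp_second_countable[OF countable_L2_steps closure_L2_steps])

instance L2 :: polish_space ..

section \<open>Covariance operators\<close>

definition tensor :: "'a::real_inner \<Rightarrow> 'b::real_vector \<Rightarrow> 'a \<Rightarrow> 'b" where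
  "tensor a b = (\<lambda>x. (a \<bullet> x) *\<^sub>R b)"

text \<open>
  \<open>E[f \<otimes> g]\<close>, evaluated pointwise: the space of bounded operators is not separable, so the
  Bochner integral is taken after applying the operator to a vector. Operators are plain
  functions throughout, with \<^const>\<open>onorm\<close> as their norm.
\<close>

definition cov_op ::
  "'w measure \<Rightarrow> ('w \<Rightarrow> 'a::real_inner) \<Rightarrow> ('w \<Rightarrow> 'b::{real_inner, banach, second_countable_topology})
    \<Rightarrow> 'a \<Rightarrow> 'b" where
  "cov_op M f g = (\<lambda>x. \<integral>\<omega>. tensor (f \<omega>) (g \<omega>) x \<partial>M)"

text \<open>The sample quantities are functions of one realized path, observed at times \<open>1, \<dots>, T\<close>.\<close>

definition sample_cov_op ::
  "nat \<Rightarrow> (int \<Rightarrow> 'a::real_inner) \<Rightarrow> (int \<Rightarrow> 'b::real_vector) \<Rightarrow> 'a \<Rightarrow> 'b" where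
  "sample_cov_op T f g = (\<lambda>x. (1 / real T) *\<^sub>R (\<Sum>t = 1..int T. tensor (f t) (g t) x))"

definition sample_cov_vec ::
  "nat \<Rightarrow> (int \<Rightarrow> real) \<Rightarrow> (int \<Rightarrow> 'b::real_vector) \<Rightarrow> 'b" where
  "sample_cov_vec T z f = (1 / real T) *\<^sub>R (\<Sum>t = 1..int T. z t *\<^sub>R f t)"

definition mean_zero ::
  "'w measure \<Rightarrow> ('w \<Rightarrow> 'b::{real_inner, banach, second_countable_topology}) \<Rightarrow> bool" where
  "mean_zero M Z \<longleftrightarrow> integrable M Z \<and> (\<integral>\<omega>. Z \<omega> \<partial>M) = 0"


section \<open>Schur complements, spectral cut-off and the estimator\<close>

definition schur ::
  "('a \<Rightarrow> 'a) \<Rightarrow> ('b \<Rightarrow> 'a) \<Rightarrow> ('a \<Rightarrow> 'b) \<Rightarrow> ('b \<Rightarrow> 'b) \<Rightarrow> 'b \<Rightarrow> 'b::real_vector" where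
  "schur G11 G12 G21 G22 = (\<lambda>x. G22 x - G21 (inv G11 (G12 x)))"

text \<open>The covariances are taken at time 0; by stationarity the time does not matter.\<close>

definition pop_schur ::
  "'w measure \<Rightarrow> (int \<Rightarrow> 'w \<Rightarrow> 'a::{real_inner, banach, second_countable_topology})
    \<Rightarrow> (int \<Rightarrow> 'w \<Rightarrow> 'b::{real_inner, banach, second_countable_topology}) \<Rightarrow> 'b \<Rightarrow> 'b" where
  "pop_schur M w X =
     schur (cov_op M (w 0) (w 0)) (cov_op M (X 0) (w 0)) (cov_op M (w 0) (X 0)) (cov_op M (X 0) (X 0))"

definition sample_schur ::
  "nat \<Rightarrow> (int \<Rightarrow> 'a::real_inner) \<Rightarrow> (int \<Rightarrow> 'b::real_inner) \<Rightarrow> 'b \<Rightarrow> 'b" where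
  "sample_schur T w X =
     schur (sample_cov_op T w w) (sample_cov_op T X w) (sample_cov_op T w X) (sample_cov_op T X X)"

text \<open>
  Indices start at 1. The eigenvectors are orthonormal but need not span the space: an operator
  with infinitely many positive eigenvalues may still have a nontrivial kernel, which the
  enumeration in decreasing order never reaches.
\<close>

definition spectral_decomposition ::
  "('b \<Rightarrow> 'b) \<Rightarrow> (nat \<Rightarrow> real) \<Rightarrow> (nat \<Rightarrow> 'b::real_inner) \<Rightarrow> bool" where
  "spectral_decomposition A l v \<longleftrightarrow>
     (\<forall>j\<ge>1. 0 \<le> l (Suc j) \<and> l (Suc j) \<le> l j) \<and>
     (\<forall>i\<ge>1. \<forall>j\<ge>1. v i \<bullet> v j = (if i = j then 1 else 0)) \<and>
     (\<forall>x. (\<lambda>n. \<Sum>j = 1..n. l j *\<^sub>R tensor (v j) (v j) x) \<longlonglongrightarrow> A x)"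

text \<open>Inserting 0 gives an empty spectral sum if no eigenvalue reaches the threshold.\<close>

definition cutoff :: "real \<Rightarrow> (nat \<Rightarrow> real) \<Rightarrow> nat" where
  "cutoff tau l = Max (insert 0 {j. j \<ge> 1 \<and> (l j)\<^sup>2 \<ge> tau})"

definition trunc_inverse ::
  "nat \<Rightarrow> (nat \<Rightarrow> real) \<Rightarrow> (nat \<Rightarrow> 'b::real_inner) \<Rightarrow> 'b \<Rightarrow> 'b" where
  "trunc_inverse K l v = (\<lambda>x. \<Sum>j = 1..K. inverse (l j) *\<^sub>R tensor (v j) (v j) x)"

definition block_op ::
  "('a \<Rightarrow> 'a) \<Rightarrow> ('b \<Rightarrow> 'a) \<Rightarrow> ('a \<Rightarrow> 'b) \<Rightarrow> ('b \<Rightarrow> 'b)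
    \<Rightarrow> 'a::real_vector \<times> 'b::real_vector \<Rightarrow> 'a \<times> 'b" where
  "block_op A11 A12 A21 A22 = (\<lambda>(a, b). (A11 a + A12 b, A21 a + A22 b))"

definition block_reg_inverse ::
  "('a \<Rightarrow> 'a) \<Rightarrow> ('b \<Rightarrow> 'a) \<Rightarrow> ('a \<Rightarrow> 'b) \<Rightarrow> ('b \<Rightarrow> 'b)
    \<Rightarrow> 'a::real_vector \<times> 'b::real_vector \<Rightarrow> 'a \<times> 'b" where
  "block_reg_inverse G11 G12 G21 R = block_op
     (\<lambda>a. inv G11 a + inv G11 (G12 (R (G21 (inv G11 a)))))
     (\<lambda>b. - inv G11 (G12 (R b)))
     (\<lambda>a. - R (G21 (inv G11 a)))
     R"

definition stack :: "(int \<Rightarrow> 'w \<Rightarrow> 'a) \<Rightarrow> (int \<Rightarrow> 'w \<Rightarrow> 'b) \<Rightarrow> int \<Rightarrow> 'w \<Rightarrow> 'a \<times> 'b" where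
  "stack w X t \<omega> = (w t \<omega>, X t \<omega>)"

definition theta_hat ::
  "nat \<Rightarrow> nat \<Rightarrow> real \<Rightarrow> (nat \<Rightarrow> real) \<Rightarrow> (nat \<Rightarrow> 'b)
    \<Rightarrow> (int \<Rightarrow> real) \<Rightarrow> (int \<Rightarrow> 'a::real_inner) \<Rightarrow> (int \<Rightarrow> 'b::real_inner) \<Rightarrow> 'a \<times> 'b" where
  "theta_hat h T tau l v y w X =
     block_reg_inverse (sample_cov_op T w w) (sample_cov_op T X w) (sample_cov_op T w X)
       (trunc_inverse (cutoff tau l) l v)
       (sample_cov_vec T (\<lambda>t. y (t + int h)) (\<lambda>t. (w t, X t)))"


section \<open>Stochastic order, stationarity and \<open>L\<^sup>p\<close>-\<open>m\<close>-approximability\<close>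

text \<open>
  \<open>Z\<^sub>T = O\<^sub>p(r\<^sub>T)\<close>. The exceptional event is only required to lie in an event of small probability,
  so that a nonmeasurable \<open>Z T\<close> cannot satisfy the condition merely because \<^const>\<open>measure\<close> is 0
  outside the \<open>\<sigma>\<close>-algebra.
\<close>

definition big_O_p :: "'w measure \<Rightarrow> (nat \<Rightarrow> 'w \<Rightarrow> real) \<Rightarrow> (nat \<Rightarrow> real) \<Rightarrow> bool" where
  "big_O_p M Z r \<longleftrightarrow>
     (\<forall>\<epsilon>>0. \<exists>K>0. \<exists>N. \<forall>T\<ge>N. \<exists>A\<in>sets M.
        {\<omega> \<in> space M. \<bar>Z T \<omega>\<bar> > K * r T} \<subseteq> A \<and> measure M A \<le> \<epsilon>)"

definition stationary ::
  "'w measure \<Rightarrow> (int \<Rightarrow> 'w \<Rightarrow> 'b::topological_space) \<Rightarrow> bool" where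
  "stationary M H \<longleftrightarrow> (\<forall>t. H t \<in> borel_measurable M) \<and>
     (\<forall>k. distr M (\<Pi>\<^sub>M t\<in>UNIV. borel) (\<lambda>\<omega> t. H (t + k) \<omega>)
        = distr M (\<Pi>\<^sub>M t\<in>UNIV. borel) (\<lambda>\<omega> t. H t \<omega>))"

text \<open>
  \<open>N\<close> is the measurable space in which the innovations \<open>e\<^sub>t\<close> take their values. The argument of
  \<open>f\<close> lists the innovations by lag. For given \<open>t\<close> and \<open>m\<close>, the independent copy
  \<open>(e\<^sup>(\<^sup>m\<^sup>)\<^bsub>t,s\<^esub>)\<^sub>s\<close> is the second component \<open>c\<close> of the extended probability space, so that \<open>M\<close> itself
  need not be rich enough to carry it.
\<close>

definition Lp_m_approximable ::
  "'w measure \<Rightarrow> 's measure \<Rightarrow> real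
    \<Rightarrow> (int \<Rightarrow> 'w \<Rightarrow> 'b::{real_inner, banach, second_countable_topology}) \<Rightarrow> bool" where
  "Lp_m_approximable M N p H \<longleftrightarrow>
     (\<exists>(f :: (nat \<Rightarrow> 's) \<Rightarrow> 'b) (e :: int \<Rightarrow> 'w \<Rightarrow> 's) \<delta> \<kappa>.
        f \<in> borel_measurable (\<Pi>\<^sub>M k\<in>UNIV. N) \<and>
        prob_space.indep_vars M (\<lambda>_. N) e UNIV \<and>
        (\<forall>t. distr M N (e t) = distr M N (e 0)) \<and>
        0 < \<delta> \<and> \<delta> < 1 \<and> p + \<delta> < \<kappa> \<and>
        (\<forall>t. H t \<in> borel_measurable M \<and>
             (AE \<omega> in M. H t \<omega> = f (\<lambda>k. e (t - int k) \<omega>)) \<and>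
             mean_zero M (H t) \<and>
             integrable M (\<lambda>\<omega>. norm (H t \<omega>) powr (p + \<delta>)) \<and>
             summable (\<lambda>i. let m = Suc i in
               (\<integral>(\<omega>, c). norm (H t \<omega> - f (\<lambda>k. if k < m then e (t - int k) \<omega> else c (t - int k)))
                   powr (p + \<delta>)
                  \<partial>(M \<Otimes>\<^sub>M (\<Pi>\<^sub>M s\<in>(UNIV :: int set). distr M N (e 0)))) powr (1 / \<kappa>))))"

end

theory Submission
  imports Defs
begin

text \<open>
  Block elimination with the sample matrix gives
  \<open>\<theta>hat - \<theta> = (\<Gamma>11hat\<^sup>-\<^sup>1 \<Gamma>12hat r, - r) + Q Chat_\<Upsilon>u\<close>, where \<open>r = \<beta> - P \<beta>\<close>, \<open>P\<close> is the projection onto the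
  eigenvectors of \<open>Shat\<close> retained by the cut-off, and the regularised inverse \<open>Q\<close> has norm
  \<open>O(\<tau>\<^sup>-\<^sup>1\<^sup>/\<^sup>2)\<close>.

  To bound \<open>r\<close>, let \<open>J\<close> be of order \<open>\<tau>\<^sup>-\<^sup>1\<^sup>/\<^sup>\<rho>\<close>, so that \<open>\<lambda>\<^sub>j \<ge> 2 \<tau>\<^sup>1\<^sup>/\<^sup>2\<close> for \<open>j \<le> J\<close>; this is possible because
  the gap condition sums to \<open>\<lambda>\<^sub>j\<^sup>2 \<ge> c j\<^sup>-\<^sup>\<rho>\<close>. Off the range of \<open>P\<close> the operator \<open>Shat\<close> has norm at most
  \<open>\<tau>\<^sup>1\<^sup>/\<^sup>2\<close>, hence each \<open>v\<^sub>j\<close> with \<open>j \<le> J\<close> is within \<open>\<parallel>Shat - S\<parallel> / \<tau>\<^sup>1\<^sup>/\<^sup>2\<close> of the range of \<open>P\<close>. The first \<open>J\<close>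
  terms of the expansion of \<open>\<beta>\<close> therefore contribute \<open>O\<^sub>p(T\<^sup>-\<^sup>1\<^sup>/\<^sup>2 \<tau>\<^sup>-\<^sup>1\<^sup>/\<^sup>2\<^sup>-\<^sup>1\<^sup>/\<^sup>\<rho>)\<close> and the remaining ones
  the bias. Neither the random index of the cut-off nor individual estimated eigenvectors have to be
  compared with their population counterparts.
\<close>

section \<open>Truncated spectral decompositions\<close>

text \<open>Index 0 stays unconstrained, as in \<open>spectral_decomposition\<close>.\<close>

definition orthonormal_from_1 :: "(nat \<Rightarrow> 'b::real_inner) \<Rightarrow> bool" where
  "orthonormal_from_1 v \<longleftrightarrow> (\<forall>i\<ge>1. \<forall>j\<ge>1. v i \<bullet> v j = (if i = j then 1 else 0))"

text \<open>Applied both to the estimated eigenvectors, with the random cut-off as \<open>K\<close>,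
  and to the population eigenvectors, with a deterministic truncation point.\<close>

definition spectral_proj :: "nat \<Rightarrow> (nat \<Rightarrow> 'b::real_inner) \<Rightarrow> 'b \<Rightarrow> 'b" where
  "spectral_proj K v x = (\<Sum>j = 1..K. (v j \<bullet> x) *\<^sub>R v j)"

section \<open>Finite orthonormal sums, Pythagoras and Bessel\<close>

lemma inner_orthonormal_sum:
  assumes "orthonormal_from_1 v" "finite F" "F \<subseteq> {1..}" "i \<ge> 1"
  shows "v i \<bullet> (\<Sum>j\<in>F. c j *\<^sub>R v j) = (if i \<in> F then c i else 0)"
proof -
  have "v i \<bullet> (\<Sum>j\<in>F. c j *\<^sub>R v j) = (\<Sum>j\<in>F. if i = j then c j else 0)"
    unfolding inner_sum_right
    by (intro sum.cong refl) (use assms in \<open>auto simp: orthonormal_from_1_def subset_iff\<close>)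
  with assms(2) show ?thesis by simp
qed

lemma norm_orthonormal_sum:
  assumes "orthonormal_from_1 v" "finite F" "F \<subseteq> {1..}"
  shows "(norm (\<Sum>j\<in>F. c j *\<^sub>R v j))\<^sup>2 = (\<Sum>j\<in>F. (c j)\<^sup>2)"
proof -
  have "(norm (\<Sum>j\<in>F. c j *\<^sub>R v j))\<^sup>2 = (\<Sum>i\<in>F. c i * (v i \<bullet> (\<Sum>j\<in>F. c j *\<^sub>R v j)))"
    by (simp add: power2_norm_eq_inner inner_sum_left)
  also have "\<dots> = (\<Sum>i\<in>F. (c i)\<^sup>2)"
    by (intro sum.cong refl)
      (use assms in \<open>auto simp: inner_orthonormal_sum power2_eq_square subset_iff\<close>)
  finally show ?thesis .
qed

text \<open>Pythagoras: with \<open>p\<close> the projected part, \<open>p \<bullet> x\<close> and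
  \<open>p \<bullet> p\<close> both equal the sum of the squared coefficients, so
  \<open>x - p\<close> is orthogonal to \<open>p\<close>.\<close>

lemma norm_orthonormal_residual:
  assumes "orthonormal_from_1 v" "finite F" "F \<subseteq> {1..}"
  shows "(norm (x - (\<Sum>j\<in>F. (v j \<bullet> x) *\<^sub>R v j)))\<^sup>2 + (\<Sum>j\<in>F. (v j \<bullet> x)\<^sup>2) = (norm x)\<^sup>2"
proof -
  define p where "p = (\<Sum>j\<in>F. (v j \<bullet> x) *\<^sub>R v j)"
  have "p \<bullet> x = (\<Sum>j\<in>F. (v j \<bullet> x)\<^sup>2)"
    by (simp add: p_def inner_sum_left power2_eq_square)
  moreover have "p \<bullet> p = (\<Sum>j\<in>F. (v j \<bullet> x)\<^sup>2)"
    using norm_orthonormal_sum[OF assms] by (simp add: p_def power2_norm_eq_inner)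
  ultimately show ?thesis
    unfolding p_def[symmetric] by (simp add: power2_norm_eq_inner inner_diff inner_commute)
qed

lemma bessel:
  assumes "orthonormal_from_1 v" "finite F" "F \<subseteq> {1..}"
  shows "(\<Sum>j\<in>F. (v j \<bullet> x)\<^sup>2) \<le> (norm x)\<^sup>2"
  using norm_orthonormal_residual[OF assms, of x] by (smt (verit) zero_le_power2)

lemma norm_spectral_residual_le:
  assumes "orthonormal_from_1 v"
  shows "norm (x - spectral_proj K v x) \<le> norm x"
proof (rule power2_le_imp_le)
  have "(\<Sum>j = 1..K. (v j \<bullet> x)\<^sup>2) \<ge> 0"
    by (simp add: sum_nonneg)
  moreover have "(norm (x - spectral_proj K v x))\<^sup>2 + (\<Sum>j = 1..K. (v j \<bullet> x)\<^sup>2) = (norm x)\<^sup>2"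
    unfolding spectral_proj_def by (rule norm_orthonormal_residual[OF assms]) auto
  ultimately show "(norm (x - spectral_proj K v x))\<^sup>2 \<le> (norm x)\<^sup>2"
    by linarith
qed simp

lemma linear_spectral_proj: "linear (spectral_proj K v)"
  unfolding spectral_proj_def
  by (intro linearI)
    (simp_all add: inner_add_right scaleR_add_left sum.distrib scaleR_sum_right)

section \<open>Eigenvalues and eigenvectors read off from a spectral decomposition\<close>

lemma spectral_decomposition_orthonormal:
  "spectral_decomposition A l v \<Longrightarrow> orthonormal_from_1 v"
  by (simp add: spectral_decomposition_def orthonormal_from_1_def)

lemma spectral_decomposition_lim:
  "spectral_decomposition A l v \<Longrightarrow> (\<lambda>n. \<Sum>j = 1..n. (l j * (v j \<bullet> x)) *\<^sub>R v j) \<longlonglongrightarrow> A x"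
  by (simp add: spectral_decomposition_def tensor_def)

lemma spectral_decomposition_nonneg:
  assumes "spectral_decomposition A l v" "j \<ge> 1"
  shows "l j \<ge> 0"
  using assms unfolding spectral_decomposition_def by (meson order_trans)

lemma spectral_decomposition_antimono:
  assumes "spectral_decomposition A l v" "1 \<le> i" "i \<le> j"
  shows "l j \<le> l i"
  using assms(3)
proof (induction rule: dec_induct)
  case (step n)
  have "l (Suc n) \<le> l n"
    using assms(1,2) step.hyps(1) unfolding spectral_decomposition_def by (meson order_trans)
  with step.IH show ?case by simp
qed simp

text \<open>Once \<open>n \<ge> i\<close>, pairing the n-th partial sum with \<open>v i\<close>
  leaves only the i-th term, and the inner product is continuous.\<close>

lemma spectral_decomposition_inner:
  assumes "spectral_decomposition A l v" "i \<ge> 1"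
  shows "v i \<bullet> A x = l i * (v i \<bullet> x)"
proof -
  have "(\<lambda>n. v i \<bullet> (\<Sum>j = 1..n. (l j * (v j \<bullet> x)) *\<^sub>R v j)) \<longlonglongrightarrow> v i \<bullet> A x"
    by (intro tendsto_intros spectral_decomposition_lim[OF assms(1)])
  moreover have "\<forall>\<^sub>F n in sequentially.
      v i \<bullet> (\<Sum>j = 1..n. (l j * (v j \<bullet> x)) *\<^sub>R v j) = l i * (v i \<bullet> x)"
    using eventually_ge_at_top[of i]
  proof eventually_elim
    case (elim n)
    have "v i \<bullet> (\<Sum>j = 1..n. (l j * (v j \<bullet> x)) *\<^sub>R v j)
        = (if i \<in> {1..n} then l i * (v i \<bullet> x) else 0)"
      by (rule inner_orthonormal_sum[OF spectral_decomposition_orthonormal[OF assms(1)]])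
        (use assms(2) in auto)
    with elim assms(2) show ?case by simp
  qed
  ultimately show ?thesis
    by (rule LIMSEQ_unique[OF _ tendsto_eventually])
qed

lemma spectral_decomposition_eigen:
  assumes "spectral_decomposition A l v" "i \<ge> 1"
  shows "A (v i) = l i *\<^sub>R v i"
proof -
  have "\<forall>\<^sub>F n in sequentially. (\<Sum>j = 1..n. (l j * (v j \<bullet> v i)) *\<^sub>R v j) = l i *\<^sub>R v i"
    using eventually_ge_at_top[of i]
  proof eventually_elim
    case (elim n)
    have "(\<Sum>j = 1..n. (l j * (v j \<bullet> v i)) *\<^sub>R v j) = (\<Sum>j = 1..n. if j = i then l i *\<^sub>R v i else 0)"
      by (intro sum.cong refl)
        (use assms(2) spectral_decomposition_orthonormal[OF assms(1)] in
          \<open>auto simp: orthonormal_from_1_def\<close>)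
    with elim assms(2) show ?case by simp
  qed
  then show ?thesis
    by (rule LIMSEQ_unique[OF spectral_decomposition_lim[OF assms(1)] tendsto_eventually])
qed

text \<open>Without this lemma, \<^const>\<open>cutoff\<close> would be the maximum of an infinite set.\<close>

lemma finite_spectrum_of_finite_rank:
  assumes sd: "spectral_decomposition A l v" and "finite B" "range A \<subseteq> span B" "\<tau> > 0"
  shows "finite {j. j \<ge> 1 \<and> (l j)\<^sup>2 \<ge> \<tau>}"
proof -
  let ?I = "{j. j \<ge> 1 \<and> (l j)\<^sup>2 \<ge> \<tau>}"
  note on = spectral_decomposition_orthonormal[OF sd, unfolded orthonormal_from_1_def, rule_format]
  have inj: "inj_on v ?I"
  proof (rule inj_onI)
    fix i j assume "i \<in> ?I" "j \<in> ?I" "v i = v j"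
    then show "i = j" using on[of i j] on[of j j] by (auto split: if_splits)
  qed
  have nz: "v j \<noteq> 0" if "j \<ge> 1" for j
    using on[OF that that] by auto
  have "independent (v ` ?I)"
    by (rule pairwise_orthogonal_independent)
      (use nz on in \<open>auto simp: pairwise_def orthogonal_def\<close>)
  \<comment> \<open>An eigenvector with nonzero eigenvalue is a multiple of its own image, hence
    lies in the range of \<open>A\<close>. An independent family inside \<open>span B\<close> is
    finite, and injectivity carries this over to the indices.\<close>
  moreover have "v ` ?I \<subseteq> span B"
  proof
    fix x assume "x \<in> v ` ?I"
    then obtain j where j: "j \<ge> 1" "(l j)\<^sup>2 \<ge> \<tau>" "x = v j" by auto
    with assms(4) have "l j \<noteq> 0" by auto
    with spectral_decomposition_eigen[OF sd j(1)] have "x = inverse (l j) *\<^sub>R A (v j)"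
      by (simp add: j(3))
    moreover have "A (v j) \<in> span B" using assms(3) by auto
    ultimately show "x \<in> span B" by (simp add: span_scale)
  qed
  ultimately have "finite (v ` ?I)"
    using independent_span_bound[OF assms(2)] by blast
  with inj show ?thesis by (simp add: finite_image_iff)
qed

text \<open>\<open>A\<close> stands for the sample Schur complement with its estimated eigenpairs;
  the population operator enters the later lemmas as \<open>B\<close>.\<close>

locale truncated_spectrum =
  fixes A :: "'b::real_inner \<Rightarrow> 'b" and l :: "nat \<Rightarrow> real" and v :: "nat \<Rightarrow> 'b" and \<tau> :: real
  assumes sd: "spectral_decomposition A l v"
    and fin: "finite {j. j \<ge> 1 \<and> (l j)\<^sup>2 \<ge> \<tau>}"
    and tau: "\<tau> > 0"
begin

abbreviation "K \<equiv> cutoff \<tau> l"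
abbreviation "P \<equiv> spectral_proj K v"

lemmas on = spectral_decomposition_orthonormal[OF sd]

lemma above_cutoff:
  assumes "j > K"
  shows "(l j)\<^sup>2 \<le> \<tau>"
proof (rule ccontr)
  assume "\<not> (l j)\<^sup>2 \<le> \<tau>"
  with assms have "j \<in> insert 0 {j. j \<ge> 1 \<and> (l j)\<^sup>2 \<ge> \<tau>}" by auto
  then have "j \<le> K"
    unfolding cutoff_def using fin by (intro Max_ge) auto
  with assms show False by simp
qed

lemma below_cutoff:
  assumes "1 \<le> j" "j \<le> K"
  shows "sqrt \<tau> \<le> l j"
proof -
  have "K \<in> insert 0 {j. j \<ge> 1 \<and> (l j)\<^sup>2 \<ge> \<tau>}"
    unfolding cutoff_def using fin by (intro Max_in) auto
  \<comment> \<open>Since \<open>1 \<le> j \<le> K\<close>, the maximum is not the default 0, so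
    \<open>K\<close> itself passes the threshold.\<close>
  with assms have K: "K \<ge> 1" "(l K)\<^sup>2 \<ge> \<tau>" by auto
  then have "sqrt \<tau> \<le> l K"
    using spectral_decomposition_nonneg[OF sd K(1)] by (simp add: real_le_lsqrt)
  with spectral_decomposition_antimono[OF sd assms] show ?thesis by simp
qed

text \<open>The factor \<open>l j\<close> which \<open>A\<close> puts on the j-th coordinate cancels
  against \<open>inverse (l j)\<close>, because the retained eigenvalues are at least
  \<open>sqrt \<tau>\<close> and so nonzero.\<close>

lemma trunc_inverse_apply: "trunc_inverse K l v (A x) = P x"
  unfolding trunc_inverse_def spectral_proj_def tensor_def
proof (intro sum.cong refl)
  fix j assume "j \<in> {1..K}"
  then have j: "1 \<le> j" "j \<le> K" by auto
  have "sqrt \<tau> > 0" using tau by simp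
  with below_cutoff[OF j] have "l j \<noteq> 0" by linarith
  then show "inverse (l j) *\<^sub>R (v j \<bullet> A x) *\<^sub>R v j = (v j \<bullet> x) *\<^sub>R v j"
    by (simp add: spectral_decomposition_inner[OF sd j(1)])
qed

text \<open>Each retained coordinate is multiplied by at most \<open>1 / sqrt \<tau>\<close>, and
  Bessel sums the coordinates. This is the factor by which noise is amplified.\<close>

lemma norm_trunc_inverse_le: "norm (trunc_inverse K l v x) \<le> norm x / sqrt \<tau>"
proof (rule power2_le_imp_le)
  have "(norm (trunc_inverse K l v x))\<^sup>2 = (\<Sum>j = 1..K. (inverse (l j) * (v j \<bullet> x))\<^sup>2)"
    using norm_orthonormal_sum[OF on, of "{1..K}" "\<lambda>j. inverse (l j) * (v j \<bullet> x)"]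
    by (simp add: trunc_inverse_def tensor_def subset_iff)
  also have "\<dots> \<le> (\<Sum>j = 1..K. (1 / \<tau>) * (v j \<bullet> x)\<^sup>2)"
  proof (intro sum_mono)
    fix j assume "j \<in> {1..K}"
    then have "sqrt \<tau> \<le> l j" by (intro below_cutoff) auto
    then have "(sqrt \<tau>)\<^sup>2 \<le> (l j)\<^sup>2"
      using tau by (intro power_mono) auto
    then have "(inverse (l j))\<^sup>2 \<le> 1 / \<tau>"
      using tau by (simp add: power_divide inverse_eq_divide frac_le)
    then show "(inverse (l j) * (v j \<bullet> x))\<^sup>2 \<le> (1 / \<tau>) * (v j \<bullet> x)\<^sup>2"
      unfolding power_mult_distrib by (rule mult_right_mono) simp
  qed
  also have "\<dots> = (1 / \<tau>) * (\<Sum>j = 1..K. (v j \<bullet> x)\<^sup>2)"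
    by (simp add: sum_distrib_left)
  also have "\<dots> \<le> (1 / \<tau>) * (norm x)\<^sup>2"
    using tau by (intro mult_left_mono bessel[OF on]) auto
  also have "\<dots> = (norm x / sqrt \<tau>)\<^sup>2"
    using tau by (simp add: power_divide)
  finally show "(norm (trunc_inverse K l v x))\<^sup>2 \<le> (norm x / sqrt \<tau>)\<^sup>2" .
qed (use tau in simp)

text \<open>Beyond the cut-off \<open>A\<close> multiplies coordinates by at most
  \<open>sqrt \<tau>\<close>. The bound is proved for the partial sums of the spectral series and
  passed to the limit.\<close>

lemma norm_residual_apply_le: "norm (A x - P (A x)) \<le> sqrt \<tau> * norm (x - P x)"
proof -
  let ?s = "\<lambda>n. \<Sum>j = 1..n. (l j * (v j \<bullet> x)) *\<^sub>R v j"
  have PA: "P (A x) = ?s K"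
    unfolding spectral_proj_def by (intro sum.cong refl) (auto simp: spectral_decomposition_inner[OF sd])
  have "(\<lambda>n. norm (?s n - P (A x))) \<longlonglongrightarrow> norm (A x - P (A x))"
    by (intro tendsto_intros spectral_decomposition_lim[OF sd])
  moreover have "\<forall>\<^sub>F n in sequentially. norm (?s n - P (A x)) \<le> sqrt \<tau> * norm (x - P x)"
    using eventually_ge_at_top[of K]
  proof eventually_elim
    case (elim n)
    have "{1..n} = {1..K} \<union> {Suc K..n}" using elim by auto
    then have eq: "?s n - P (A x) = (\<Sum>j\<in>{Suc K..n}. (l j * (v j \<bullet> x)) *\<^sub>R v j)"
      unfolding PA by (simp add: sum.union_disjoint)
    have "(norm (?s n - P (A x)))\<^sup>2 = (\<Sum>j\<in>{Suc K..n}. (l j * (v j \<bullet> x))\<^sup>2)"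
      unfolding eq by (intro norm_orthonormal_sum[OF on]) auto
    also have "\<dots> \<le> (\<Sum>j\<in>{Suc K..n}. \<tau> * (v j \<bullet> (x - P x))\<^sup>2)"
    proof (intro sum_mono)
      fix j assume j: "j \<in> {Suc K..n}"
      \<comment> \<open>Beyond the cut-off, \<open>x\<close> and its residual have the same
        coordinates; this puts \<open>x - P x\<close> instead of \<open>x\<close> into the Bessel
        bound.\<close>
      then have "v j \<bullet> P x = 0"
        unfolding spectral_proj_def by (subst inner_orthonormal_sum[OF on]) auto
      with j show "(l j * (v j \<bullet> x))\<^sup>2 \<le> \<tau> * (v j \<bullet> (x - P x))\<^sup>2"
        by (simp add: inner_diff_right power_mult_distrib mult_right_mono above_cutoff)
    qed
    also have "\<dots> \<le> \<tau> * (norm (x - P x))\<^sup>2"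
      unfolding sum_distrib_left[symmetric] using tau by (intro mult_left_mono bessel[OF on]) auto
    also have "\<dots> = (sqrt \<tau> * norm (x - P x))\<^sup>2"
      using tau by (simp add: power_mult_distrib)
    finally show ?case
      by (rule power2_le_imp_le) (use tau in simp)
  qed
  ultimately show ?thesis
    by (intro tendsto_upperbound) auto
qed

text \<open>A one-sided Davis-Kahan argument: apply \<open>I - P\<close> to
  \<open>m z = (B - A) z + A z\<close>. The first term costs at most \<open>D\<close>; the second at
  most \<open>sqrt \<tau>\<close> times the residual itself, which
  \<open>m \<ge> 2 * sqrt \<tau>\<close> allows to be absorbed on the left.\<close>

lemma norm_eigenvector_residual_le:
  assumes eigen: "B z = m *\<^sub>R z" "norm z = 1" "m \<ge> 2 * sqrt \<tau>"
    and near: "\<And>x. norm (A x - B x) \<le> D * norm x"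
  shows "norm (z - P z) \<le> D / sqrt \<tau>"
proof -
  interpret P: linear P by (rule linear_spectral_proj)
  have "m *\<^sub>R (z - P z) = ((B z - A z) - P (B z - A z)) + (A z - P (A z))"
    by (simp add: eigen(1) P.diff P.scaleR algebra_simps)
  then have "norm (m *\<^sub>R (z - P z))
      \<le> norm ((B z - A z) - P (B z - A z)) + norm (A z - P (A z))"
    by (metis norm_triangle_ineq)
  also have "norm ((B z - A z) - P (B z - A z)) \<le> D"
    using norm_spectral_residual_le[OF on, of "B z - A z" K] near[of z] eigen(2)
    by (simp add: norm_minus_commute)
  also have "norm (A z - P (A z)) \<le> sqrt \<tau> * norm (z - P z)"
    by (rule norm_residual_apply_le)
  finally have 1: "norm (m *\<^sub>R (z - P z)) \<le> D + sqrt \<tau> * norm (z - P z)" by simp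
  have "0 < sqrt \<tau>" using tau by simp
  with eigen(3) have "2 * sqrt \<tau> * norm (z - P z) \<le> norm (m *\<^sub>R (z - P z))"
    by (simp add: mult_right_mono)
  with 1 have "sqrt \<tau> * norm (z - P z) \<le> D" by linarith
  with \<open>0 < sqrt \<tau>\<close> show ?thesis by (simp add: field_simps)
qed

text \<open>Split \<open>b\<close> into its first \<open>J\<close> population terms and the rest.
  The rest passes through the contraction \<open>I - P\<close>; each of the \<open>J\<close> terms
  has coefficient at most \<open>norm b\<close> and residual at most \<open>D / sqrt \<tau>\<close>,
  and the triangle inequality gives the factor \<open>J\<close>.\<close>

lemma norm_spectral_residual_perturb:
  assumes sdB: "spectral_decomposition B m z" and near: "\<And>x. norm (A x - B x) \<le> D * norm x"
    and large: "\<And>j. 1 \<le> j \<Longrightarrow> j \<le> J \<Longrightarrow> m j \<ge> 2 * sqrt \<tau>"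
  shows "norm (b - P b) \<le> norm (b - spectral_proj J z b) + real J * norm b * D / sqrt \<tau>"
proof -
  interpret P: linear P by (rule linear_spectral_proj)
  note onB = spectral_decomposition_orthonormal[OF sdB]
  let ?p = "spectral_proj J z b"
  have nz: "norm (z j) = 1" if "j \<ge> 1" for j
    using onB that by (simp add: orthonormal_from_1_def norm_eq_sqrt_inner)
  have "norm (?p - P ?p) = norm (\<Sum>j = 1..J. (z j \<bullet> b) *\<^sub>R (z j - P (z j)))"
    by (simp add: spectral_proj_def[of J z] P.sum P.scaleR scaleR_diff_right sum_subtractf)
  also have "\<dots> \<le> (\<Sum>j = 1..J. norm b * (D / sqrt \<tau>))"
  proof (intro sum_norm_le)
    fix j assume j: "j \<in> {1..J}"
    have "\<bar>z j \<bullet> b\<bar> \<le> norm b"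
      using Cauchy_Schwarz_ineq2[of "z j" b] nz[of j] j by simp
    moreover have "norm (z j - P (z j)) \<le> D / sqrt \<tau>"
      by (rule norm_eigenvector_residual_le[where B=B and m="m j"])
        (use j nz large near spectral_decomposition_eigen[OF sdB] in auto)
    ultimately show "norm ((z j \<bullet> b) *\<^sub>R (z j - P (z j))) \<le> norm b * (D / sqrt \<tau>)"
      unfolding norm_scaleR real_norm_def by (intro mult_mono) auto
  qed
  also have "\<dots> = real J * norm b * D / sqrt \<tau>" by simp
  finally have 1: "norm (?p - P ?p) \<le> real J * norm b * D / sqrt \<tau>" .
  have "b - P b = ((b - ?p) - P (b - ?p)) + (?p - P ?p)"
    by (simp add: P.diff)
  then have "norm (b - P b) \<le> norm ((b - ?p) - P (b - ?p)) + norm (?p - P ?p)"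
    by (metis norm_triangle_ineq)
  with 1 norm_spectral_residual_le[OF on, of "b - ?p" K] show ?thesis by simp
qed

end

section \<open>Rates\<close>

text \<open>Sum the gaps over the dyadic block from \<open>j\<close> to \<open>2 * j\<close> and
  drop \<open>a (2 * j) \<ge> 0\<close>. Each of the \<open>j\<close> gaps is at least
  \<open>c * (2 * j) powr (-\<rho> - 1)\<close>, whence the constant.\<close>

lemma power_gap_lower_bound:
  fixes a :: "nat \<Rightarrow> real"
  assumes gap: "\<And>j. j \<ge> 1 \<Longrightarrow> a j - a (Suc j) \<ge> c * real j powr (-\<rho> - 1)"
    and nonneg: "\<And>j. j \<ge> 1 \<Longrightarrow> a j \<ge> 0" and "c > 0" "\<rho> > 0" "j \<ge> 1"
  shows "a j \<ge> c * 2 powr (-\<rho> - 1) * real j powr (-\<rho>)"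
proof -
  have "c * 2 powr (-\<rho> - 1) * real j powr (-\<rho>) = (\<Sum>k\<in>{j..<2*j}. c * real (2 * j) powr (-\<rho> - 1))"
    using assms(5) by (simp add: powr_mult powr_diff)
  also have "\<dots> \<le> (\<Sum>k\<in>{j..<2*j}. a k - a (Suc k))"
  proof (intro sum_mono)
    fix k assume k: "k \<in> {j..<2*j}"
    have "c * real (2 * j) powr (-\<rho> - 1) \<le> c * real k powr (-\<rho> - 1)"
      using k assms(3-5) by (intro mult_left_mono powr_mono2') auto
    also have "\<dots> \<le> a k - a (Suc k)"
      using k assms(5) by (intro gap) auto
    finally show "c * real (2 * j) powr (-\<rho> - 1) \<le> a k - a (Suc k)" .
  qed
  also have "\<dots> = a j - a (2 * j)"
    using sum_Suc_diff'[of j "2 * j" "\<lambda>k. - a k"] by simp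
  also have "\<dots> \<le> a j"
    using nonneg[of "2 * j"] assms(5) by simp
  finally show ?thesis .
qed

text \<open>Mean value theorem for the power \<open>1 - s\<close> on the interval from
  \<open>x\<close> to \<open>x + 1\<close>. The intermediate point is below
  \<open>x + 1 \<le> 2 * x\<close>, which costs the factor \<open>2 powr s\<close>.\<close>

lemma powr_minus_le_telescope:
  fixes x s :: real
  assumes "s > 1" "x \<ge> 1"
  shows "x powr (-s) \<le> 2 powr s / (s - 1) * (x powr (1 - s) - (x + 1) powr (1 - s))"
proof -
  have "\<exists>z. x < z \<and> z < x + 1 \<and>
      (x + 1) powr (1 - s) - x powr (1 - s) = (x + 1 - x) * ((1 - s) * z powr (1 - s - 1))"
    using assms by (intro MVT2) (auto intro!: derivative_eq_intros)
  then obtain z where z: "x < z" "z < x + 1"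
    and eq: "(x + 1) powr (1 - s) - x powr (1 - s) = (1 - s) * z powr (- s)"
    by auto
  have "2 powr (-s) * x powr (-s) = (2 * x) powr (-s)"
    using assms by (simp add: powr_mult)
  also have "\<dots> \<le> z powr (-s)"
    using assms z by (intro powr_mono2') auto
  also have "\<dots> = (x powr (1 - s) - (x + 1) powr (1 - s)) / (s - 1)"
    using eq assms by (simp add: field_simps)
  finally have "2 powr (-s) * x powr (-s) \<le> (x powr (1 - s) - (x + 1) powr (1 - s)) / (s - 1)" .
  then have "2 powr s * (2 powr (-s) * x powr (-s))
      \<le> 2 powr s * ((x powr (1 - s) - (x + 1) powr (1 - s)) / (s - 1))"
    by (intro mult_left_mono) auto
  moreover have "2 powr s * (2 powr (-s) * x powr (-s)) = x powr (-s)"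
    by (simp add: powr_minus field_simps)
  ultimately show ?thesis by simp
qed

lemma sum_powr_tail_le:
  assumes "s > 1" "1 \<le> m"
  shows "(\<Sum>j\<in>{m..<n}. real j powr (-s)) \<le> 2 powr s / (s - 1) * real m powr (1 - s)"
proof (cases "m \<le> n")
  case True
  let ?c = "2 powr s / (s - 1)"
  have "(\<Sum>j\<in>{m..<n}. real j powr (-s))
      \<le> (\<Sum>j\<in>{m..<n}. - (?c * real (Suc j) powr (1 - s)) - - (?c * real j powr (1 - s)))"
  proof (intro sum_mono)
    fix j assume "j \<in> {m..<n}"
    then show "real j powr (-s) \<le> - (?c * real (Suc j) powr (1 - s)) - - (?c * real j powr (1 - s))"
      using powr_minus_le_telescope[OF assms(1), of "real j"] assms(2)
      by (simp add: algebra_simps)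
  qed
  also have "\<dots> = ?c * real m powr (1 - s) - ?c * real n powr (1 - s)"
    using sum_Suc_diff'[OF True, of "\<lambda>j. - (?c * real j powr (1 - s))"] by simp
  also have "\<dots> \<le> ?c * real m powr (1 - s)"
    using assms(1) by simp
  finally show ?thesis .
qed (use assms in auto)

text \<open>The squared norm of the tail is the sum of the squared coefficients, of order
  \<open>j powr (-2 * \<sigma>)\<close>, summable as \<open>\<sigma> > 1/2\<close>; the root of the
  tail sum has exponent \<open>1/2 - \<sigma>\<close>. The base is the first omitted index
  \<open>Suc J\<close>, so \<open>J = 0\<close> is covered.\<close>

lemma norm_expansion_tail_le:
  fixes v :: "nat \<Rightarrow> 'b::real_inner"
  assumes on: "orthonormal_from_1 v"
    and lim: "(\<lambda>n. spectral_proj n v b) \<longlonglongrightarrow> b"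
    and decay: "\<And>j. j \<ge> 1 \<Longrightarrow> \<bar>b \<bullet> v j\<bar> \<le> C * real j powr (-\<sigma>)" and "\<sigma> > 1/2" "C \<ge> 0"
  shows "norm (b - spectral_proj J v b)
    \<le> C * sqrt (2 powr (2 * \<sigma>) / (2 * \<sigma> - 1)) * real (Suc J) powr (1/2 - \<sigma>)"
proof (rule tendsto_upperbound)
  show "(\<lambda>n. norm (spectral_proj n v b - spectral_proj J v b)) \<longlonglongrightarrow> norm (b - spectral_proj J v b)"
    by (intro tendsto_intros lim)
  let ?D = "2 powr (2 * \<sigma>) / (2 * \<sigma> - 1)"
  show "\<forall>\<^sub>F n in sequentially. norm (spectral_proj n v b - spectral_proj J v b)
      \<le> C * sqrt ?D * real (Suc J) powr (1/2 - \<sigma>)"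
    using eventually_ge_at_top[of J]
  proof eventually_elim
    case (elim n)
    have "spectral_proj n v b - spectral_proj J v b = (\<Sum>j\<in>{1..n} - {1..J}. (v j \<bullet> b) *\<^sub>R v j)"
      unfolding spectral_proj_def by (rule sum_diff[symmetric]) (use elim in auto)
    also have "{1..n} - {1..J} = {Suc J..<Suc n}" by auto
    finally have "(norm (spectral_proj n v b - spectral_proj J v b))\<^sup>2 = (\<Sum>j\<in>{Suc J..<Suc n}. (v j \<bullet> b)\<^sup>2)"
      using norm_orthonormal_sum[OF on, of "{Suc J..<Suc n}" "\<lambda>j. v j \<bullet> b"] by force
    also have "\<dots> \<le> (\<Sum>j\<in>{Suc J..<Suc n}. C\<^sup>2 * real j powr (-(2 * \<sigma>)))"
    proof (intro sum_mono)
      fix j assume "j \<in> {Suc J..<Suc n}"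
      then have "\<bar>v j \<bullet> b\<bar> \<le> C * real j powr (-\<sigma>)"
        using decay[of j] by (simp add: inner_commute)
      then have "\<bar>v j \<bullet> b\<bar>\<^sup>2 \<le> (C * real j powr (-\<sigma>))\<^sup>2"
        by (intro power_mono) auto
      also have "\<dots> = C\<^sup>2 * real j powr (-(2 * \<sigma>))"
        by (simp add: power_mult_distrib power2_eq_square[of "_ powr _"] flip: powr_add)
      finally show "(v j \<bullet> b)\<^sup>2 \<le> C\<^sup>2 * real j powr (-(2 * \<sigma>))" by simp
    qed
    also have "\<dots> \<le> C\<^sup>2 * (?D * real (Suc J) powr (1 - 2 * \<sigma>))"
      unfolding sum_distrib_left[symmetric]
      using sum_powr_tail_le[of "2 * \<sigma>" "Suc J" "Suc n"] assms(4)
      by (intro mult_left_mono) auto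
    also have "\<dots> = (C * sqrt ?D * real (Suc J) powr (1/2 - \<sigma>))\<^sup>2"
      using assms(4)
      by (simp add: power_mult_distrib power2_eq_square[of "_ powr (1/2 - \<sigma>)"]
          flip: powr_add)
    finally show ?case
      by (rule power2_le_imp_le) (use assms in simp)
  qed
qed simp

section \<open>Rate of the projection residual\<close>

context truncated_spectrum
begin

text \<open>The tail of \<open>b\<close> shrinks and the perturbation term grows with the truncation
  point. It is taken as large as the eigenvalue bound permits, of order
  \<open>\<tau> powr (-1/\<rho>)\<close>: inserted in the tail this gives the bias exponent, and as
  the number of terms it gives the extra \<open>-1/\<rho>\<close>.\<close>

lemma norm_spectral_residual_rate:
  assumes sdB: "spectral_decomposition B m z" and near: "\<And>x. norm (A x - B x) \<le> D * norm x"
    and lower: "\<And>j. j \<ge> 1 \<Longrightarrow> (m j)\<^sup>2 \<ge> 4 * g * real j powr (-\<rho>)" and "g > 0" "\<rho> > 0"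
    and lim: "(\<lambda>n. spectral_proj n z b) \<longlonglongrightarrow> b"
    and decay: "\<And>j. j \<ge> 1 \<Longrightarrow> \<bar>b \<bullet> z j\<bar> \<le> C * real j powr (-\<sigma>)" and "\<sigma> > 1/2" "C \<ge> 0" "D \<ge> 0"
  shows "norm (b - P b)
    \<le> C * sqrt (2 powr (2 * \<sigma>) / (2 * \<sigma> - 1)) * (g powr (1/\<rho>)) powr (1/2 - \<sigma>)
        * \<tau> powr ((2 * \<sigma> - 1) / (2 * \<rho>))
      + g powr (1/\<rho>) * norm b * D * \<tau> powr (-1/2 - 1/\<rho>)"
proof -
  \<comment> \<open>The solution of \<open>g * x powr (-\<rho>) = \<tau>\<close>: up to
    \<open>x\<close> the assumption \<open>lower\<close> gives
    \<open>(m j)\<^sup>2 \<ge> 4 * \<tau>\<close>, which is the threshold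
    \<open>2 * sqrt \<tau>\<close>.\<close>
  define x where "x = (g / \<tau>) powr (1 / \<rho>)"
  define J where "J = nat \<lfloor>x\<rfloor>"
  have x_eq: "x = g powr (1/\<rho>) * \<tau> powr (-1/\<rho>)"
    using assms(4,5) tau
    by (simp add: x_def powr_divide powr_minus_divide)
  have x: "x > 0" using assms(4) tau by (simp add: x_def)
  \<comment> \<open>The first bound controls the number of perturbed terms. The second controls the
    tail, where the exponent \<open>1/2 - \<sigma>\<close> is negative.\<close>
  have J: "real J \<le> x" "x \<le> real (Suc J)"
    using x by (simp_all add: J_def) linarith+
  have large: "m j \<ge> 2 * sqrt \<tau>" if j: "1 \<le> j" "j \<le> J" for j
  proof -
    have "real j powr \<rho> \<le> x powr \<rho>"
      using j J assms(5) by (intro powr_mono2) auto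
    also have "\<dots> = g / \<tau>"
      using assms(4,5) tau by (simp add: x_def powr_powr)
    finally have "\<tau> \<le> g * real j powr (-\<rho>)"
      using tau j by (simp add: powr_minus field_simps)
    with lower[OF j(1)] have "4 * \<tau> \<le> (m j)\<^sup>2" by simp
    then have "(2 * sqrt \<tau>)\<^sup>2 \<le> (m j)\<^sup>2"
      using tau by (simp add: power_mult_distrib)
    then show ?thesis
      by (rule power2_le_imp_le) (rule spectral_decomposition_nonneg[OF sdB j(1)])
  qed
  have "norm (b - P b) \<le> norm (b - spectral_proj J z b) + real J * norm b * D / sqrt \<tau>"
    by (rule norm_spectral_residual_perturb[OF sdB near large])
  also have "norm (b - spectral_proj J z b)
      \<le> C * sqrt (2 powr (2 * \<sigma>) / (2 * \<sigma> - 1)) * real (Suc J) powr (1/2 - \<sigma>)"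
    by (rule norm_expansion_tail_le[OF spectral_decomposition_orthonormal[OF sdB] lim decay])
      (use assms in auto)
  also have "\<dots> \<le> C * sqrt (2 powr (2 * \<sigma>) / (2 * \<sigma> - 1)) * x powr (1/2 - \<sigma>)"
    using assms(8,9) x J by (intro mult_left_mono powr_mono2') auto
  also have "x powr (1/2 - \<sigma>) = (g powr (1/\<rho>)) powr (1/2 - \<sigma>) * \<tau> powr ((2 * \<sigma> - 1) / (2 * \<rho>))"
  proof -
    have "-1/\<rho> * (1/2 - \<sigma>) = (2 * \<sigma> - 1) / (2 * \<rho>)"
      using assms(5) by (simp add: field_simps)
    then have "(\<tau> powr (-1/\<rho>)) powr (1/2 - \<sigma>) = \<tau> powr ((2 * \<sigma> - 1) / (2 * \<rho>))"
      by (simp only: powr_powr)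
    then show ?thesis
      unfolding x_eq by (simp add: powr_mult)
  qed
  also have "real J * norm b * D / sqrt \<tau> \<le> x * norm b * D / sqrt \<tau>"
    using J assms(10) tau by (intro divide_right_mono mult_right_mono) auto
  also have "\<dots> = g powr (1/\<rho>) * norm b * D * (\<tau> powr (-1/\<rho>) * \<tau> powr (-1/2))"
    using tau unfolding x_eq by (simp add: powr_minus_divide powr_half_sqrt)
  also have "\<tau> powr (-1/\<rho>) * \<tau> powr (-1/2) = \<tau> powr (-1/2 - 1/\<rho>)"
    unfolding powr_add[symmetric] by (rule arg_cong[where f="(powr) \<tau>"]) simp
  finally show ?thesis by (simp add: mult.assoc)
qed

end

section \<open>Perturbation of block operators\<close>

lemma linear_trunc_inverse: "linear (trunc_inverse K l v)"
  unfolding trunc_inverse_def tensor_def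
  by (intro linearI)
    (simp_all add: inner_add_right scaleR_add_left scaleR_add_right sum.distrib scaleR_sum_right
      mult.left_commute)

lemma linear_inv_of_bij:
  assumes "linear f" "bij f"
  shows "linear (inv f)"
proof -
  interpret linear f by fact
  have "inv f (f x) = x" "f (inv f y) = y" for x y
    using assms(2) by (simp_all add: bij_is_inj bij_is_surj surj_f_inv_f)
  then show ?thesis
    by (intro linearI) (metis add, metis scaleR)
qed

lemma norm_add3_le: "norm (x + y + z) \<le> norm x + norm y + norm z"
  using norm_triangle_ineq[of "x + y" z] norm_triangle_ineq[of x y] by linarith

lemma norm_fst_le_norm: "norm (fst z) \<le> norm z"
  by (metis norm_fst_le prod.collapse)

lemma norm_snd_le_norm: "norm (snd z) \<le> norm z"
  by (metis norm_snd_le prod.collapse)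

text \<open>Block elimination: subtracting \<open>G21\<close> composed with \<open>inv G11\<close>
  times the first row from the second removes \<open>a\<close> and leaves the Schur complement of
  \<open>b\<close>. For \<open>R\<close> its exact inverse the result would be
  \<open>(a, b)\<close>, so the formula isolates the effect of regularisation.\<close>

lemma block_reg_inverse_block_op:
  assumes G: "linear G12" "linear G21" "linear G11" and bij: "bij G11" and R: "linear R"
  shows "block_reg_inverse G11 G12 G21 R (block_op G11 G12 G21 G22 (a, b))
    = (a + inv G11 (G12 (b - R (schur G11 G12 G21 G22 b))), R (schur G11 G12 G21 G22 b))"
proof -
  interpret G12: linear G12 by fact
  interpret G21: linear G21 by fact
  interpret R: linear R by fact
  interpret I: linear "inv G11" by (rule linear_inv_of_bij[OF assms(3) bij])
  have inv: "inv G11 (G11 a) = a"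
    using bij by (simp add: bij_is_inj)
  show ?thesis
    by (simp add: block_reg_inverse_def block_op_def schur_def inv
        I.add I.diff G12.add G12.diff G21.add R.add R.diff I.neg)
qed

text \<open>The operator is \<open>inv G11\<close> in the first block plus a product column -
  \<open>R\<close> - row, whose outer factors have norm at most \<open>1 + q * B\<close> each. The
  proof bounds the five terms separately, and they add up to the square.\<close>

lemma norm_block_reg_inverse_le:
  assumes inv: "\<And>x. norm (inv G11 x) \<le> q * norm x"
    and G12: "\<And>x. norm (G12 x) \<le> B * norm x" and G21: "\<And>x. norm (G21 x) \<le> B * norm x"
    and R: "\<And>x. norm (R x) \<le> r * norm x" and nonneg: "q \<ge> 0" "B \<ge> 0" "r \<ge> 0"
  shows "norm (block_reg_inverse G11 G12 G21 R (a, b)) \<le> (q + (1 + q * B)\<^sup>2 * r) * norm (a, b)"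
proof -
  let ?n = "norm (a, b)"
  have a: "norm a \<le> ?n" and b: "norm b \<le> ?n"
    using norm_fst_le_norm[of "(a, b)"] norm_snd_le_norm[of "(a, b)"] by simp_all
  have ia: "norm (inv G11 a) \<le> q * ?n"
    using order_trans[OF inv mult_left_mono[OF a]] nonneg by simp
  have ga: "norm (G21 (inv G11 a)) \<le> B * (q * ?n)"
    by (rule order_trans[OF G21]) (intro mult_left_mono ia nonneg)
  have ra: "norm (R (G21 (inv G11 a))) \<le> r * (B * (q * ?n))"
    by (rule order_trans[OF R]) (intro mult_left_mono ga nonneg)
  have rb: "norm (R b) \<le> r * ?n"
    using order_trans[OF R mult_left_mono[OF b]] nonneg by simp
  have up: "norm (inv G11 (G12 x)) \<le> q * (B * s)" if "norm x \<le> s" for x s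
    using that nonneg
    by (intro order_trans[OF inv] mult_left_mono order_trans[OF G12]) auto
  have "norm (block_reg_inverse G11 G12 G21 R (a, b))
      \<le> norm (inv G11 a + inv G11 (G12 (R (G21 (inv G11 a)))) + - inv G11 (G12 (R b)))
        + norm (- R (G21 (inv G11 a)) + R b)"
    unfolding block_reg_inverse_def block_op_def by (simp add: norm_Pair_le)
  also have "\<dots> \<le> (norm (inv G11 a) + norm (inv G11 (G12 (R (G21 (inv G11 a))))) + norm (inv G11 (G12 (R b))))
        + (norm (R (G21 (inv G11 a))) + norm (R b))"
    by (intro add_mono order_trans[OF norm_add3_le] order_trans[OF norm_triangle_ineq]) auto
  also have "\<dots> \<le> (q * ?n + q * (B * (r * (B * (q * ?n)))) + q * (B * (r * ?n)))
        + (r * (B * (q * ?n)) + r * ?n)"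
    by (intro add_mono ia up ra rb)
  also have "\<dots> = (q + (1 + q * B)\<^sup>2 * r) * ?n"
    by (simp add: power2_eq_square algebra_simps)
  finally show ?thesis .
qed

text \<open>\<open>G\<close> holds the population blocks and \<open>H\<close> the sample blocks on
  an event where their distance is at most \<open>d\<close>. The bound \<open>d \<le> c / 2\<close>
  keeps \<open>H11\<close> bounded below, and \<open>d \<le> 1\<close> bounds the sample operator by
  \<open>B + 1\<close>.\<close>

locale perturbed_block =
  fixes G11 H11 :: "'a::euclidean_space \<Rightarrow> 'a" and G12 H12 :: "'b::real_inner \<Rightarrow> 'a"
    and G21 H21 :: "'a \<Rightarrow> 'b" and G22 H22 :: "'b \<Rightarrow> 'b" and c B d :: real
  assumes linear_G: "linear G11" "linear G12" "linear G21" "linear G22"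
    and linear_H: "linear H11" "linear H12" "linear H21" "linear H22"
    and bij_G: "bij G11" and below: "\<And>a. c * norm a \<le> norm (G11 a)" and c: "c > 0"
    and bound: "\<And>z. norm (block_op G11 G12 G21 G22 z) \<le> B * norm z" and B: "B \<ge> 0"
    and near: "\<And>z. norm (block_op H11 H12 H21 H22 z - block_op G11 G12 G21 G22 z) \<le> d * norm z"
    and d: "0 \<le> d" "d \<le> c / 2" "d \<le> 1"
begin

sublocale G11: linear G11 by (rule linear_G)
sublocale G12: linear G12 by (rule linear_G)
sublocale G21: linear G21 by (rule linear_G)
sublocale G22: linear G22 by (rule linear_G)
sublocale H11: linear H11 by (rule linear_H)
sublocale H12: linear H12 by (rule linear_H)
sublocale H21: linear H21 by (rule linear_H)
sublocale H22: linear H22 by (rule linear_H)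

abbreviation "S \<equiv> schur G11 G12 G21 G22"
abbreviation "S' \<equiv> schur H11 H12 H21 H22"

lemma near_blocks:
  "norm (H11 a + H12 b - (G11 a + G12 b)) \<le> d * norm (a, b)"
  "norm (H21 a + H22 b - (G21 a + G22 b)) \<le> d * norm (a, b)"
  using near[of "(a, b)"]
    norm_fst_le_norm[of "block_op H11 H12 H21 H22 (a, b) - block_op G11 G12 G21 G22 (a, b)"]
    norm_snd_le_norm[of "block_op H11 H12 H21 H22 (a, b) - block_op G11 G12 G21 G22 (a, b)"]
  by (simp_all add: block_op_def)

lemma bound_H: "norm (block_op H11 H12 H21 H22 z) \<le> (B + 1) * norm z"
proof -
  have "norm (block_op H11 H12 H21 H22 z)
      \<le> norm (block_op H11 H12 H21 H22 z - block_op G11 G12 G21 G22 z) + norm (block_op G11 G12 G21 G22 z)"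
    by (metis diff_add_cancel norm_triangle_ineq)
  also have "\<dots> \<le> d * norm z + B * norm z"
    by (intro add_mono near bound)
  also have "\<dots> \<le> (B + 1) * norm z"
    using d(3) mult_right_mono[OF d(3) norm_ge_zero[of z]] by (simp add: algebra_simps)
  finally show ?thesis .
qed

lemma bound_G12: "norm (G12 b) \<le> B * norm b"
  using order_trans[OF norm_fst_le_norm bound[of "(0, b)"]]
  by (simp add: block_op_def norm_Pair)

lemma bound_H12: "norm (H12 b) \<le> (B + 1) * norm b"
  using order_trans[OF norm_fst_le_norm bound_H[of "(0, b)"]]
  by (simp add: block_op_def norm_Pair)

lemma bound_H21: "norm (H21 a) \<le> (B + 1) * norm a"
  using order_trans[OF norm_snd_le_norm bound_H[of "(a, 0)"]]
  by (simp add: block_op_def norm_Pair)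

lemma below_H: "c / 2 * norm a \<le> norm (H11 a)"
proof -
  have "norm (H11 a - G11 a) \<le> c / 2 * norm a"
    using near_blocks(1)[of a 0] mult_right_mono[OF d(2) norm_ge_zero[of a]]
    by (simp add: norm_Pair)
  moreover have "norm (G11 a) \<le> norm (H11 a) + norm (H11 a - G11 a)"
    by (metis norm_minus_commute norm_triangle_sub)
  ultimately show ?thesis
    using below[of a] by simp
qed

text \<open>The lower bound \<open>below_H\<close> gives injectivity, which suffices in finite
  dimension.\<close>

lemma bij_H: "bij H11"
proof -
  have "inj H11"
    unfolding H11.inj_iff_eq_0
  proof safe
    fix a assume "H11 a = 0"
    with below_H[of a] c show "a = 0"
      by (simp add: mult_le_0_iff)
  qed
  then show ?thesis
    using linear_inj_imp_surj linear_H(1) by (blast intro: bijI)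
qed

lemma norm_inv_H_le: "norm (inv H11 a) \<le> 2 / c * norm a"
proof -
  have "H11 (inv H11 a) = a"
    using bij_H by (simp add: bij_is_surj surj_f_inv_f)
  with below_H[of "inv H11 a"] c show ?thesis by (simp add: field_simps)
qed

text \<open>\<open>S x\<close> is the second component of the block operator at
  \<open>(-p, x)\<close>, where \<open>p\<close> is chosen so that the first component vanishes;
  \<open>S' x\<close> arises likewise from \<open>p'\<close>. The difference splits into the
  perturbed second row at \<open>(-p, x)\<close> and the effect of replacing \<open>p\<close> by
  \<open>p'\<close>.\<close>

lemma schur_near:
  "norm (S' x - S x) \<le> (1 + (B + 1) * (2 / c)) * (1 + B / c) * d * norm x"
proof -
  define p where "p = inv G11 (G12 x)"
  define p' where "p' = inv H11 (H12 x)"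
  have p: "G11 p = G12 x" "H11 p' = H12 x"
    using bij_G bij_H by (simp_all add: p_def p'_def bij_is_surj surj_f_inv_f)
  have "c * norm p \<le> B * norm x"
    using below[of p] bound_G12[of x] p by simp
  then have np: "norm p \<le> B / c * norm x"
    using c by (simp add: field_simps)
  have "norm (-p, x) \<le> norm p + norm x"
    using norm_Pair_le[of "-p" x] by simp
  with np have nz: "norm (-p, x) \<le> (1 + B / c) * norm x"
    by (simp add: algebra_simps)
  \<comment> \<open>The subtracted bracket is zero by the choice of \<open>p\<close>; in this form
    the right-hand side is the perturbation of the first row.\<close>
  have "H11 (p' - p) = H11 (-p) + H12 x - (G11 (-p) + G12 x)"
    by (simp add: p H11.diff H11.neg G11.neg)
  then have "c / 2 * norm (p' - p) \<le> d * norm (-p, x)"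
    using below_H[of "p' - p"] near_blocks(1)[of "-p" x] by simp
  then have dp: "norm (p' - p) \<le> 2 / c * (d * norm (-p, x))"
    using c by (simp add: field_simps)
  have "S' x - S x = (H21 (-p) + H22 x - (G21 (-p) + G22 x)) + - H21 (p' - p)"
    by (simp add: schur_def H21.diff H21.neg G21.neg flip: p_def p'_def)
  then have "norm (S' x - S x)
      \<le> norm (H21 (-p) + H22 x - (G21 (-p) + G22 x)) + norm (H21 (p' - p))"
    by (metis norm_minus_cancel norm_triangle_ineq)
  also have "\<dots> \<le> d * norm (-p, x) + (B + 1) * (2 / c * (d * norm (-p, x)))"
    by (rule add_mono[OF near_blocks(2) order_trans[OF bound_H21 mult_left_mono[OF dp]]])
      (use B in simp)
  also have "\<dots> = (1 + (B + 1) * (2 / c)) * d * norm (-p, x)"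
    by (simp add: algebra_simps)
  also have "\<dots> \<le> (1 + (B + 1) * (2 / c)) * d * ((1 + B / c) * norm x)"
    using nz B c d by (intro mult_left_mono) auto
  finally show ?thesis by (simp add: mult_ac)
qed

lemma norm_estimation_error_le:
  assumes "truncated_spectrum S' l v \<tau>"
  defines "K \<equiv> cutoff \<tau> l"
  shows "norm (block_reg_inverse H11 H12 H21 (trunc_inverse K l v)
            (block_op H11 H12 H21 H22 (a, b) + e) - (a, b))
    \<le> (1 + 2 / c * (B + 1)) * norm (b - spectral_proj K v b)
      + (2 / c + (1 + 2 / c * (B + 1))\<^sup>2 / sqrt \<tau>) * norm e"
proof -
  interpret T: truncated_spectrum S' l v \<tau> by fact
  let ?R = "trunc_inverse K l v"
  let ?Q = "block_reg_inverse H11 H12 H21 ?R"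
  let ?r = "b - spectral_proj K v b"
  interpret R: linear ?R by (rule linear_trunc_inverse)
  interpret I: linear "inv H11" by (rule linear_inv_of_bij[OF linear_H(1) bij_H])
  have Q_add: "?Q (z + e) = ?Q z + ?Q e" for z
    by (cases z, cases e)
      (simp add: block_reg_inverse_def block_op_def R.add I.add H12.add H21.add)
  \<comment> \<open>Without noise the truncated inverse turns \<open>S' b\<close> into the
    projection of \<open>b\<close>, so only the residual \<open>?r\<close> survives.\<close>
  have "?Q (block_op H11 H12 H21 H22 (a, b)) - (a, b) = (inv H11 (H12 ?r), - ?r)"
    by (subst block_reg_inverse_block_op[OF linear_H(2,3,1) bij_H linear_trunc_inverse])
      (simp add: T.trunc_inverse_apply K_def)
  then have "?Q (block_op H11 H12 H21 H22 (a, b) + e) - (a, b) = (inv H11 (H12 ?r), - ?r) + ?Q e"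
    unfolding Q_add diff_add_eq[symmetric] by simp
  then have "norm (?Q (block_op H11 H12 H21 H22 (a, b) + e) - (a, b))
      \<le> norm (inv H11 (H12 ?r), - ?r) + norm (?Q e)"
    by (metis norm_triangle_ineq)
  also have "\<dots> \<le> (norm (inv H11 (H12 ?r)) + norm ?r) + norm (?Q e)"
    using norm_Pair_le[of "inv H11 (H12 ?r)" "- ?r"] unfolding norm_minus_cancel by simp
  also have "norm (inv H11 (H12 ?r)) \<le> 2 / c * ((B + 1) * norm ?r)"
    by (rule order_trans[OF norm_inv_H_le mult_left_mono[OF bound_H12]]) (use c in simp)
  also have "2 / c * ((B + 1) * norm ?r) + norm ?r = (1 + 2 / c * (B + 1)) * norm ?r"
    by (simp only: distrib_right mult_1 mult.assoc add.commute)
  also have "norm (?Q e) \<le> (2 / c + (1 + 2 / c * (B + 1))\<^sup>2 * (1 / sqrt \<tau>)) * norm e"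
  proof (cases e)
    case (Pair e1 e2)
    show ?thesis
      unfolding Pair
    proof (rule norm_block_reg_inverse_le)
      show "norm (?R x) \<le> 1 / sqrt \<tau> * norm x" for x
        using T.norm_trunc_inverse_le[of x] by (simp add: K_def)
    qed (use norm_inv_H_le bound_H12 bound_H21 c B T.tau in auto)
  qed
  finally show ?thesis by simp
qed

text \<open>Inserts the residual rate with the Schur complement error as \<open>D\<close>, and puts
  all stochastic terms under one power of \<open>\<tau>\<close>.\<close>

lemma norm_estimation_error_rate:
  assumes sd: "spectral_decomposition S l v"
    and trunc: "truncated_spectrum S' l' v' \<tau>" and tau: "\<tau> \<le> 1"
    and lower: "\<And>j. j \<ge> 1 \<Longrightarrow> (l j)\<^sup>2 \<ge> 4 * g * real j powr (-\<rho>)" and g: "g > 0" "\<rho> > 0"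
    and lim: "(\<lambda>n. spectral_proj n v b) \<longlonglongrightarrow> b"
    and decay: "\<And>j. j \<ge> 1 \<Longrightarrow> \<bar>b \<bullet> v j\<bar> \<le> C * real j powr (-\<sigma>)" and C: "\<sigma> > 1/2" "C \<ge> 0"
  shows "norm (block_reg_inverse H11 H12 H21 (trunc_inverse (cutoff \<tau> l') l' v')
            (block_op H11 H12 H21 H22 (a, b) + e) - (a, b))
    \<le> (1 + 2 / c * (B + 1)) *
        (C * sqrt (2 powr (2 * \<sigma>) / (2 * \<sigma> - 1)) * (g powr (1/\<rho>)) powr (1/2 - \<sigma>))
        * \<tau> powr ((2 * \<sigma> - 1) / (2 * \<rho>))
      + ((1 + 2 / c * (B + 1)) *
          (g powr (1/\<rho>) * norm b * ((1 + (B + 1) * (2 / c)) * (1 + B / c) * d))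
         + (2 / c + (1 + 2 / c * (B + 1))\<^sup>2) * norm e) * \<tau> powr (-1/2 - 2/\<rho>)"
    (is "_ \<le> ?q * ?E * ?y + (?q * (?F * (?k * d)) + (2 / c + ?q\<^sup>2) * norm e) * ?z")
proof -
  interpret T: truncated_spectrum S' l' v' \<tau> by fact
  have q: "?q \<ge> 0" and k: "?k \<ge> 0" using B c by simp_all
  \<comment> \<open>As \<open>\<tau> \<le> 1\<close>, the most negative exponent dominates the
    perturbation of the residual, the noise amplification and the constant
    \<open>2 / c\<close>.\<close>
  have z: "\<tau> powr (-1/2 - 1/\<rho>) \<le> ?z" "\<tau> powr (-1/2) \<le> ?z" "\<tau> powr 0 \<le> ?z"
    using T.tau tau g(2) by (intro powr_mono'; simp add: field_simps)+
  have "\<tau> powr (-1/2) = 1 / sqrt \<tau>"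
    using T.tau by (simp add: powr_minus_divide powr_half_sqrt)
  with z T.tau have z': "1 / sqrt \<tau> \<le> ?z" "1 \<le> ?z" by simp_all
  have "norm (b - T.P b) \<le> ?E * ?y + ?F * (?k * d) * \<tau> powr (-1/2 - 1/\<rho>)"
    by (rule T.norm_spectral_residual_rate[OF sd schur_near lower g lim decay C])
      (use k d in auto)
  also have "\<dots> \<le> ?E * ?y + ?F * (?k * d) * ?z"
    using z(1) k d by (intro add_left_mono mult_left_mono) auto
  finally have 1: "norm (b - T.P b) \<le> ?E * ?y + ?F * (?k * d) * ?z" .
  have 2: "2 / c + ?q\<^sup>2 / sqrt \<tau> \<le> (2 / c + ?q\<^sup>2) * ?z"
  proof -
    have "2 / c * 1 + ?q\<^sup>2 * (1 / sqrt \<tau>) \<le> 2 / c * ?z + ?q\<^sup>2 * ?z"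
      by (intro add_mono mult_left_mono z') (use c in auto)
    then show ?thesis by (simp add: algebra_simps)
  qed
  have "norm (block_reg_inverse H11 H12 H21 (trunc_inverse (cutoff \<tau> l') l' v')
      (block_op H11 H12 H21 H22 (a, b) + e) - (a, b))
      \<le> ?q * norm (b - T.P b) + (2 / c + ?q\<^sup>2 / sqrt \<tau>) * norm e"
    by (rule norm_estimation_error_le[OF trunc])
  also have "\<dots> \<le> ?q * (?E * ?y + ?F * (?k * d) * ?z) + ((2 / c + ?q\<^sup>2) * ?z) * norm e"
    by (intro add_mono mult_left_mono mult_right_mono 1 2 q norm_ge_zero)
  also have "\<dots> = ?q * ?E * ?y + (?q * (?F * (?k * d)) + (2 / c + ?q\<^sup>2) * norm e) * ?z"
    by (simp only: distrib_left distrib_right mult_ac)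
  finally show ?thesis .
qed

end

section \<open>Covariance operators and stochastic order\<close>

lemma sample_cov_op_Pair:
  "sample_cov_op T (\<lambda>t. (w t, x t)) (\<lambda>t. (w t, x t))
    = block_op (sample_cov_op T w w) (sample_cov_op T x w) (sample_cov_op T w x) (sample_cov_op T x x)"
  by (rule ext, rule prod_eqI)
    (auto simp: sample_cov_op_def block_op_def tensor_def inner_prod_def fst_sum snd_sum
      scaleR_add_left sum.distrib scaleR_add_right split: prod.splits)

lemma sample_cov_vec_linear_model:
  assumes "\<And>t. z t = \<theta> \<bullet> f t + u t"
  shows "sample_cov_vec T z f = sample_cov_op T f f \<theta> + sample_cov_vec T u f"
  by (simp add: sample_cov_vec_def sample_cov_op_def tensor_def assms inner_commute
      scaleR_add_left sum.distrib scaleR_add_right)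

lemma bounded_linear_sample_cov_op:
  fixes f :: "int \<Rightarrow> 'a::real_inner" and g :: "int \<Rightarrow> 'b::real_normed_vector"
  shows "bounded_linear (sample_cov_op T f g)"
  unfolding sample_cov_op_def tensor_def
  by (intro bounded_linear_const_scaleR bounded_linear_sum bounded_linear_scaleR_const
      bounded_linear_inner_right)

lemma range_sample_cov_op: "sample_cov_op T f g z \<in> span (g ` {1..int T})"
  unfolding sample_cov_op_def tensor_def by (intro span_scale span_sum) (auto intro: span_base)

text \<open>Both terms of the Schur complement are combinations of the observed \<open>x t\<close>.
  This is the finite rank that \<open>finite_spectrum_of_finite_rank\<close> asks for.\<close>

lemma range_sample_schur: "range (sample_schur T w x) \<subseteq> span (x ` {1..int T})"
  unfolding sample_schur_def schur_def by (auto intro!: span_diff range_sample_cov_op)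

section \<open>Population covariance operators\<close>

lemma norm_tensor: "norm (tensor a b x) \<le> norm a * norm b * norm x"
  using mult_right_mono[OF Cauchy_Schwarz_ineq2[of a x] norm_ge_zero[of b]]
  by (simp add: tensor_def mult_ac)

lemma integrable_tensor:
  fixes f :: "'w \<Rightarrow> 'a::{real_inner, second_countable_topology}"
    and g :: "'w \<Rightarrow> 'b::{real_inner, banach, second_countable_topology}"
  assumes [measurable]: "f \<in> borel_measurable M" "g \<in> borel_measurable M"
    and "integrable M (\<lambda>\<omega>. (norm (f \<omega>))\<^sup>2)" "integrable M (\<lambda>\<omega>. (norm (g \<omega>))\<^sup>2)"
  shows "integrable M (\<lambda>\<omega>. tensor (f \<omega>) (g \<omega>) x)"
proof (rule Bochner_Integration.integrable_bound)
  show "integrable M (\<lambda>\<omega>. ((norm (f \<omega>))\<^sup>2 + (norm (g \<omega>))\<^sup>2) * norm x)"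
    using assms by auto
  show "(\<lambda>\<omega>. tensor (f \<omega>) (g \<omega>) x) \<in> borel_measurable M"
    unfolding tensor_def by measurable
  have "norm a * norm b \<le> (norm a)\<^sup>2 + (norm b)\<^sup>2" for a :: 'a and b :: 'b
    using sum_squares_bound[of "norm a" "norm b"] mult_nonneg_nonneg[of "norm a" "norm b"]
    by (simp del: mult_nonneg_nonneg)
  then show "AE \<omega> in M. norm (tensor (f \<omega>) (g \<omega>) x) \<le> norm (((norm (f \<omega>))\<^sup>2 + (norm (g \<omega>))\<^sup>2) * norm x)"
    by (intro AE_I2 order_trans[OF norm_tensor]) (simp add: mult_right_mono)
qed

lemma linear_cov_op:
  fixes f :: "'w \<Rightarrow> 'a::{real_inner, second_countable_topology}"
    and g :: "'w \<Rightarrow> 'b::{real_inner, banach, second_countable_topology}"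
  assumes "f \<in> borel_measurable M" "g \<in> borel_measurable M"
    and "integrable M (\<lambda>\<omega>. (norm (f \<omega>))\<^sup>2)" "integrable M (\<lambda>\<omega>. (norm (g \<omega>))\<^sup>2)"
  shows "linear (cov_op M f g)"
proof (rule linearI)
  fix x y :: 'a and r :: real
  show "cov_op M f g (x + y) = cov_op M f g x + cov_op M f g y"
    unfolding cov_op_def
    by (subst Bochner_Integration.integral_add[OF integrable_tensor[OF assms] integrable_tensor[OF assms], symmetric])
      (simp add: tensor_def inner_add_right scaleR_add_left)
  show "cov_op M f g (r *\<^sub>R x) = r *\<^sub>R cov_op M f g x"
    unfolding cov_op_def by (simp add: tensor_def flip: scaleR_scaleR)
qed

lemma norm_cov_op_le:
  fixes f :: "'w \<Rightarrow> 'a::{real_inner, banach, second_countable_topology}"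
  assumes "f \<in> borel_measurable M" "integrable M (\<lambda>\<omega>. (norm (f \<omega>))\<^sup>2)"
  shows "norm (cov_op M f f x) \<le> (\<integral>\<omega>. (norm (f \<omega>))\<^sup>2 \<partial>M) * norm x"
proof -
  have "norm (cov_op M f f x) \<le> (\<integral>\<omega>. norm (tensor (f \<omega>) (f \<omega>) x) \<partial>M)"
    unfolding cov_op_def by (rule integral_norm_bound)
  also have "\<dots> \<le> (\<integral>\<omega>. (norm (f \<omega>))\<^sup>2 * norm x \<partial>M)"
  proof (rule integral_mono)
    show "integrable M (\<lambda>\<omega>. norm (tensor (f \<omega>) (f \<omega>) x))"
      by (intro integrable_norm integrable_tensor assms)
    show "norm (tensor (f \<omega>) (f \<omega>) x) \<le> (norm (f \<omega>))\<^sup>2 * norm x" for \<omega>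
      using norm_tensor[of "f \<omega>" "f \<omega>" x] by (simp add: power2_eq_square)
  qed (use assms in auto)
  finally show ?thesis by simp
qed

text \<open>Boundedness is what turns a bound on \<open>onorm\<close> into a bound at each
  vector.\<close>

lemma bounded_linear_cov_op:
  fixes f :: "'w \<Rightarrow> 'a::{real_inner, banach, second_countable_topology}"
  assumes "f \<in> borel_measurable M" "integrable M (\<lambda>\<omega>. (norm (f \<omega>))\<^sup>2)"
  shows "bounded_linear (cov_op M f f)"
proof -
  interpret linear "cov_op M f f" using assms by (intro linear_cov_op)
  show ?thesis
    by (rule bounded_linear_intro[where K="\<integral>\<omega>. (norm (f \<omega>))\<^sup>2 \<partial>M"])
      (use norm_cov_op_le[OF assms] in \<open>auto simp: add scale mult.commute\<close>)
qed

lemma cov_op_Pair: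
  fixes f :: "'w \<Rightarrow> 'a::{real_inner, banach, second_countable_topology}"
    and g :: "'w \<Rightarrow> 'b::{real_inner, banach, second_countable_topology}"
  assumes f: "f \<in> borel_measurable M" "integrable M (\<lambda>\<omega>. (norm (f \<omega>))\<^sup>2)"
    and g: "g \<in> borel_measurable M" "integrable M (\<lambda>\<omega>. (norm (g \<omega>))\<^sup>2)"
  shows "cov_op M (\<lambda>\<omega>. (f \<omega>, g \<omega>)) (\<lambda>\<omega>. (f \<omega>, g \<omega>))
    = block_op (cov_op M f f) (cov_op M g f) (cov_op M f g) (cov_op M g g)"
proof (rule ext)
  fix z :: "'a \<times> 'b"
  obtain a b where z: "z = (a, b)" by (cases z)
  note int = integrable_tensor[OF f(1) f(1) f(2) f(2)] integrable_tensor[OF g(1) f(1) g(2) f(2)]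
    integrable_tensor[OF f(1) g(1) f(2) g(2)] integrable_tensor[OF g(1) g(1) g(2) g(2)]
  have eq: "tensor (f \<omega>, g \<omega>) (f \<omega>, g \<omega>) z
      = (tensor (f \<omega>) (f \<omega>) a + tensor (g \<omega>) (f \<omega>) b, tensor (f \<omega>) (g \<omega>) a + tensor (g \<omega>) (g \<omega>) b)" for \<omega>
    by (simp add: z tensor_def scaleR_add_left)
  have i: "integrable M (\<lambda>\<omega>. tensor (f \<omega>, g \<omega>) (f \<omega>, g \<omega>) z)"
    by (intro integrable_tensor) (use f g in \<open>auto simp: norm_Pair intro!: borel_measurable_Pair\<close>)
  have "fst (\<integral>\<omega>. tensor (f \<omega>, g \<omega>) (f \<omega>, g \<omega>) z \<partial>M) = cov_op M f f a + cov_op M g f b"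
    unfolding cov_op_def integral_bounded_linear[OF bounded_linear_fst i, symmetric]
    using int by (simp add: eq)
  moreover have "snd (\<integral>\<omega>. tensor (f \<omega>, g \<omega>) (f \<omega>, g \<omega>) z \<partial>M) = cov_op M f g a + cov_op M g g b"
    unfolding cov_op_def integral_bounded_linear[OF bounded_linear_snd i, symmetric]
    using int by (simp add: eq)
  ultimately show "cov_op M (\<lambda>\<omega>. (f \<omega>, g \<omega>)) (\<lambda>\<omega>. (f \<omega>, g \<omega>)) z
      = block_op (cov_op M f f) (cov_op M g f) (cov_op M f g) (cov_op M g g) z"
    unfolding block_op_def z by (simp add: cov_op_def prod_eq_iff)
qed

section \<open>Second moments and stochastic order\<close>

lemma Lp_m_approximable_measurable:
  "Lp_m_approximable M N p H \<Longrightarrow> H t \<in> borel_measurable M"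
  unfolding Lp_m_approximable_def by blast

lemma Lp_m_approximable_square_integrable:
  assumes "prob_space M" "Lp_m_approximable M N p H" "p \<ge> 2"
  shows "integrable M (\<lambda>\<omega>. (norm (H t \<omega>))\<^sup>2)"
proof -
  interpret prob_space M by fact
  have [measurable]: "H t \<in> borel_measurable M"
    by (rule Lp_m_approximable_measurable[OF assms(2)])
  obtain \<delta> where \<delta>: "0 < \<delta>" "integrable M (\<lambda>\<omega>. norm (H t \<omega>) powr (p + \<delta>))"
    using assms(2) unfolding Lp_m_approximable_def by blast
  have le: "x\<^sup>2 \<le> 1 + x powr (p + \<delta>)" if "x \<ge> 0" for x :: real
  proof (cases "x \<le> 1")
    case True
    then have "x\<^sup>2 \<le> 1" using that by (simp add: power_le_one)
    then show ?thesis using powr_ge_zero[of x "p + \<delta>"] by linarith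
  next
    case False
    then have "x powr 2 \<le> x powr (p + \<delta>)"
      using \<delta>(1) assms(3) by (intro powr_mono) auto
    then show ?thesis using False by simp
  qed
  show ?thesis
  proof (rule Bochner_Integration.integrable_bound)
    show "integrable M (\<lambda>\<omega>. 1 + norm (H t \<omega>) powr (p + \<delta>))"
      using \<delta>(2) by simp
    show "AE \<omega> in M. norm ((norm (H t \<omega>))\<^sup>2) \<le> norm (1 + norm (H t \<omega>) powr (p + \<delta>))"
      by (rule AE_I2) (use le in simp)
  qed measurable
qed

text \<open>Reduces a stochastic rate to a deterministic implication: outside two exceptional events
  of probability at most \<open>\<epsilon> / 2\<close> each and a null set, both inputs obey their
  bounds. \<open>K\<close> may depend on \<open>K1\<close> and \<open>K2\<close>, hence on
  \<open>\<epsilon>\<close>, but the threshold for \<open>T\<close> must be uniform in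
  \<open>\<omega>\<close>.\<close>

lemma big_O_p_combine:
  assumes Z1: "big_O_p M Z1 r" and Z2: "big_O_p M Z2 r" and ae: "AE \<omega> in M. P \<omega>"
    and imp: "\<And>K1 K2. K1 > 0 \<Longrightarrow> K2 > 0 \<Longrightarrow> \<exists>K>0. \<forall>\<^sub>F T in sequentially. \<forall>\<omega>\<in>space M.
      P \<omega> \<longrightarrow> \<bar>Z1 T \<omega>\<bar> \<le> K1 * r T \<longrightarrow> \<bar>Z2 T \<omega>\<bar> \<le> K2 * r T \<longrightarrow> \<bar>Z T \<omega>\<bar> \<le> K * s T"
  shows "big_O_p M Z s"
  unfolding big_O_p_def
proof (intro allI impI)
  fix \<epsilon> :: real assume "\<epsilon> > 0"
  then have \<epsilon>: "\<epsilon> / 2 > 0" by simp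
  obtain K1 n1 where K1: "K1 > 0" and A1: "\<forall>T\<ge>n1. \<exists>A\<in>sets M. {\<omega> \<in> space M. \<bar>Z1 T \<omega>\<bar> > K1 * r T} \<subseteq> A \<and> measure M A \<le> \<epsilon> / 2"
    using Z1[unfolded big_O_p_def, rule_format, OF \<epsilon>] by blast
  obtain K2 n2 where K2: "K2 > 0" and A2: "\<forall>T\<ge>n2. \<exists>A\<in>sets M. {\<omega> \<in> space M. \<bar>Z2 T \<omega>\<bar> > K2 * r T} \<subseteq> A \<and> measure M A \<le> \<epsilon> / 2"
    using Z2[unfolded big_O_p_def, rule_format, OF \<epsilon>] by blast
  obtain U where U: "{\<omega> \<in> space M. \<not> P \<omega>} \<subseteq> U" "emeasure M U = 0" "U \<in> sets M"
    using ae by (rule AE_E)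
  obtain K where K: "K > 0" and ev: "\<forall>\<^sub>F T in sequentially. \<forall>\<omega>\<in>space M.
      P \<omega> \<longrightarrow> \<bar>Z1 T \<omega>\<bar> \<le> K1 * r T \<longrightarrow> \<bar>Z2 T \<omega>\<bar> \<le> K2 * r T \<longrightarrow> \<bar>Z T \<omega>\<bar> \<le> K * s T"
    using imp[OF K1 K2] by (elim exE conjE)
  then obtain n where n: "\<forall>T\<ge>n. \<forall>\<omega>\<in>space M.
      P \<omega> \<longrightarrow> \<bar>Z1 T \<omega>\<bar> \<le> K1 * r T \<longrightarrow> \<bar>Z2 T \<omega>\<bar> \<le> K2 * r T \<longrightarrow> \<bar>Z T \<omega>\<bar> \<le> K * s T"
    unfolding eventually_sequentially by (elim exE)
  have "\<exists>A\<in>sets M. {\<omega> \<in> space M. \<bar>Z T \<omega>\<bar> > K * s T} \<subseteq> A \<and> measure M A \<le> \<epsilon>"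
    if T: "T \<ge> max n (max n1 n2)" for T
  proof -
    from T obtain A where A: "A \<in> sets M" "{\<omega> \<in> space M. \<bar>Z1 T \<omega>\<bar> > K1 * r T} \<subseteq> A" "measure M A \<le> \<epsilon> / 2"
      using A1 by auto
    from T obtain A' where A': "A' \<in> sets M" "{\<omega> \<in> space M. \<bar>Z2 T \<omega>\<bar> > K2 * r T} \<subseteq> A'" "measure M A' \<le> \<epsilon> / 2"
      using A2 by auto
    have "measure M (A \<union> A' \<union> U) \<le> measure M A + measure M A' + measure M U"
      using A A' U by (intro order_trans[OF measure_Un_le] add_mono) auto
    also have "\<dots> \<le> \<epsilon>"
      using A A' U by (simp add: measure_def)
    finally have "measure M (A \<union> A' \<union> U) \<le> \<epsilon>" .
    moreover have "{\<omega> \<in> space M. \<bar>Z T \<omega>\<bar> > K * s T} \<subseteq> A \<union> A' \<union> U"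
    proof safe
      fix \<omega> assume \<omega>: "\<omega> \<in> space M" "K * s T < \<bar>Z T \<omega>\<bar>" "\<omega> \<notin> U" "\<omega> \<notin> A'"
      show "\<omega> \<in> A"
      proof (rule ccontr)
        assume "\<omega> \<notin> A"
        with \<omega> A(2) A'(2) U(1) have "P \<omega>" "\<bar>Z1 T \<omega>\<bar> \<le> K1 * r T" "\<bar>Z2 T \<omega>\<bar> \<le> K2 * r T"
          by (auto simp: not_less[symmetric])
        with n[rule_format, of T \<omega>] T \<omega> show False by simp
      qed
    qed
    ultimately show ?thesis using A A' U by (intro bexI[of _ "A \<union> A' \<union> U"]) auto
  qed
  with K show "\<exists>K>0. \<exists>N. \<forall>T\<ge>N. \<exists>A\<in>sets M. {\<omega> \<in> space M. \<bar>Z T \<omega>\<bar> > K * s T} \<subseteq> A \<and> measure M A \<le> \<epsilon>"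
    by blast
qed

theorem theorem1:
  fixes M :: "'w measure"
    and N1 :: "'s1 measure" and N2 :: "'s2 measure" and N3 :: "'s3 measure"
    and y u :: "int \<Rightarrow> 'w \<Rightarrow> real"
    and w :: "int \<Rightarrow> 'w \<Rightarrow> real ^ 'm"
    and X :: "int \<Rightarrow> 'w \<Rightarrow> L2"
    and h :: nat
    and \<alpha> :: "real ^ 'm" and \<beta> :: L2
    and \<tau> :: "nat \<Rightarrow> real"
    and l :: "nat \<Rightarrow> real" and v :: "nat \<Rightarrow> L2"
    and lhat :: "nat \<Rightarrow> 'w \<Rightarrow> nat \<Rightarrow> real" and vhat :: "nat \<Rightarrow> 'w \<Rightarrow> nat \<Rightarrow> L2"
    and \<rho> \<sigma> :: real
  assumes prob: "prob_space M"
    and centred: "\<And>t. mean_zero M (y t)" "\<And>t. mean_zero M (w t)" "\<And>t. mean_zero M (X t)"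
    and Gamma11_invertible: "bij (cov_op M (w 0) (w 0))"
    and spectral_S: "spectral_decomposition (pop_schur M w X) l v"
    and spectral_S_hat: "\<And>T \<omega>. \<omega> \<in> space M \<Longrightarrow>
          bij (sample_cov_op T (\<lambda>t. w t \<omega>) (\<lambda>t. w t \<omega>)) \<Longrightarrow>
          spectral_decomposition (sample_schur T (\<lambda>t. w t \<omega>) (\<lambda>t. X t \<omega>)) (lhat T \<omega>) (vhat T \<omega>)"
    and tau_pos: "\<And>T. T \<ge> 1 \<Longrightarrow> \<tau> T > 0"
    and tau_lim: "\<tau> \<longlonglongrightarrow> 0"
    and kernel: "\<And>x. cov_op M (stack w X 0) (stack w X 0) x = 0 \<Longrightarrow> x \<bullet> (\<alpha>, \<beta>) = 0"
    and model: "\<And>t. AE \<omega> in M. y (t + int h) \<omega> = (\<alpha>, \<beta>) \<bullet> stack w X t \<omega> + u t \<omega>"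
    and exogenous: "\<And>t. mean_zero M (\<lambda>\<omega>. u t \<omega> *\<^sub>R stack w X t \<omega>)"
    and stationary_Upsilon: "stationary M (stack w X)"
    and stationary_u: "stationary M u"
    and stationary_u_Upsilon: "stationary M (\<lambda>t \<omega>. u t \<omega> *\<^sub>R stack w X t \<omega>)"
    and approx_Upsilon: "Lp_m_approximable M N1 4 (stack w X)"
    and approx_u: "Lp_m_approximable M N2 4 u"
    and approx_u_Upsilon: "Lp_m_approximable M N3 4 (\<lambda>t \<omega>. u t \<omega> *\<^sub>R stack w X t \<omega>)"
    and rate_C_u: "big_O_p M
          (\<lambda>T \<omega>. norm (sample_cov_vec T (\<lambda>t. u t \<omega>) (\<lambda>t. stack w X t \<omega>)))
          (\<lambda>T. real T powr (-1/2))"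
    and rate_C: "big_O_p M
          (\<lambda>T \<omega>. onorm (\<lambda>x. sample_cov_op T (\<lambda>t. stack w X t \<omega>) (\<lambda>t. stack w X t \<omega>) x
                            - cov_op M (stack w X 0) (stack w X 0) x))
          (\<lambda>T. real T powr (-1/2))"
    and rate_Gamma11_inv: "big_O_p M
          (\<lambda>T \<omega>. onorm (\<lambda>x. inv (sample_cov_op T (\<lambda>t. w t \<omega>) (\<lambda>t. w t \<omega>)) x
                            - inv (cov_op M (w 0) (w 0)) x))
          (\<lambda>T. real T powr (-1/2))"
    and rho: "\<rho> > 2"
    and eigenvalue_decay: "\<exists>C>0. \<forall>j\<ge>1. (l j)\<^sup>2 \<le> C * real j powr (-\<rho>)"
    and eigenvalue_gap: "\<exists>C>0. \<forall>j\<ge>1. (l j)\<^sup>2 - (l (Suc j))\<^sup>2 \<ge> C * real j powr (-\<rho> - 1)"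
    and sigma: "\<sigma> > 1/2"
    and coefficient_decay: "\<exists>C>0. \<forall>j\<ge>1. \<bar>\<beta> \<bullet> v j\<bar> \<le> C * real j powr (-\<sigma>)"
    \<comment> \<open>\<open>\<beta>\<close> is orthogonal to the kernel of \<open>S\<close>. This does not follow from \<open>kernel\<close>, and the
      conclusion fails without it.\<close>
    and expansion: "(\<lambda>n. \<Sum>j = 1..n. (\<beta> \<bullet> v j) *\<^sub>R v j) \<longlonglongrightarrow> \<beta>"
    and bandwidth: "filterlim (\<lambda>T. real T * \<tau> T powr (1 + 4 / \<rho>)) at_top sequentially"
  shows "big_O_p M
          (\<lambda>T \<omega>. norm (theta_hat h T (\<tau> T) (lhat T \<omega>) (vhat T \<omega>)
                           (\<lambda>t. y t \<omega>) (\<lambda>t. w t \<omega>) (\<lambda>t. X t \<omega>) - (\<alpha>, \<beta>)))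
          (\<lambda>T. real T powr (-1/2) * \<tau> T powr (-1/2 - 2 / \<rho>)
                + \<tau> T powr ((2 * \<sigma> - 1) / (2 * \<rho>)))"
proof -
  interpret prob_space M by (rule prob)
  let ?\<Upsilon> = "stack w X 0"
  have \<Upsilon>: "?\<Upsilon> \<in> borel_measurable M" "integrable M (\<lambda>\<omega>. (norm (?\<Upsilon> \<omega>))\<^sup>2)"
    by (rule Lp_m_approximable_measurable[OF approx_Upsilon])
      (rule Lp_m_approximable_square_integrable[OF prob approx_Upsilon], simp)
  have stack_eq: "stack w X t = (\<lambda>\<omega>. (w t \<omega>, X t \<omega>))" for t
    by (simp add: stack_def fun_eq_iff)
  have wX: "w 0 \<in> borel_measurable M" "X 0 \<in> borel_measurable M"
    using centred(2,3)[of 0] by (auto simp: mean_zero_def)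
  \<comment> \<open>Each component is dominated in norm by the pair.\<close>
  have sq: "integrable M (\<lambda>\<omega>. (norm (w 0 \<omega>))\<^sup>2)" "integrable M (\<lambda>\<omega>. (norm (X 0 \<omega>))\<^sup>2)"
    by (rule Bochner_Integration.integrable_bound[OF \<Upsilon>(2)];
        use wX in \<open>simp add: stack_eq norm_Pair\<close>)+
  let ?G11 = "cov_op M (w 0) (w 0)" and ?G12 = "cov_op M (X 0) (w 0)"
    and ?G21 = "cov_op M (w 0) (X 0)" and ?G22 = "cov_op M (X 0) (X 0)"
  have lin: "linear ?G11" "linear ?G12" "linear ?G21" "linear ?G22"
    by (intro linear_cov_op wX sq)+
  have C_block: "cov_op M ?\<Upsilon> ?\<Upsilon> = block_op ?G11 ?G12 ?G21 ?G22"
    unfolding stack_eq by (rule cov_op_Pair[OF wX(1) sq(1) wX(2) sq(2)])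
  \<comment> \<open>In finite dimension an injective linear map is bounded below.\<close>
  obtain c where c: "c > 0" "\<And>a. c * norm a \<le> norm (?G11 a)"
    using linear_inj_bounded_below_pos[OF lin(1) bij_is_inj[OF Gamma11_invertible]] by blast
  define B where "B = (\<integral>\<omega>. (norm (?\<Upsilon> \<omega>))\<^sup>2 \<partial>M)"
  have B: "B \<ge> 0" by (simp add: B_def)
  have bound: "norm (block_op ?G11 ?G12 ?G21 ?G22 z) \<le> B * norm z" for z
    using norm_cov_op_le[OF \<Upsilon>] unfolding C_block B_def .
  obtain C where C: "C > 0" "\<And>j. j \<ge> 1 \<Longrightarrow> \<bar>\<beta> \<bullet> v j\<bar> \<le> C * real j powr (-\<sigma>)"
    using coefficient_decay by blast
  obtain c0 where c0: "c0 > 0" "\<And>j. j \<ge> 1 \<Longrightarrow> (l j)\<^sup>2 - (l (Suc j))\<^sup>2 \<ge> c0 * real j powr (-\<rho> - 1)"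
    using eigenvalue_gap by blast
  \<comment> \<open>Chosen so that \<open>4 * g\<close> is the constant of
    \<open>power_gap_lower_bound\<close>.\<close>
  define g where "g = c0 * 2 powr (-\<rho> - 1) / 4"
  have g: "g > 0" using c0(1) by (simp add: g_def)
  have \<rho>: "\<rho> > 0" using rho by simp
  have lower: "(l j)\<^sup>2 \<ge> 4 * g * real j powr (-\<rho>)" if "j \<ge> 1" for j
    using power_gap_lower_bound[of c0 \<rho> "\<lambda>j. (l j)\<^sup>2", OF c0(2) _ c0(1) \<rho> that]
    by (simp add: g_def)
  have lim: "(\<lambda>n. spectral_proj n v \<beta>) \<longlonglongrightarrow> \<beta>"
    using expansion by (simp add: spectral_proj_def inner_commute)
  let ?q = "1 + 2 / c * (B + 1)"
  let ?E = "C * sqrt (2 powr (2 * \<sigma>) / (2 * \<sigma> - 1)) * (g powr (1/\<rho>)) powr (1/2 - \<sigma>)"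
  let ?F = "g powr (1/\<rho>) * norm \<beta>"
  let ?k = "(1 + (B + 1) * (2 / c)) * (1 + B / c)"
  have nonneg: "?q \<ge> 0" "?E \<ge> 0" "?F \<ge> 0" "?k \<ge> 0" "2 / c \<ge> 0"
    using c(1) B C(1) sigma by simp_all
  have T_lim: "(\<lambda>T. K * real T powr (-1/2)) \<longlonglongrightarrow> 0" for K
    by (rule tendsto_mult_right_zero)
      (rule tendsto_neg_powr[OF _ filterlim_real_sequentially], simp)
  show ?thesis
  proof (rule big_O_p_combine[OF rate_C rate_C_u])
    \<comment> \<open>The integers are countable, so a single null set serves all times.\<close>
    show "AE \<omega> in M. \<forall>t. y (t + int h) \<omega> = (\<alpha>, \<beta>) \<bullet> stack w X t \<omega> + u t \<omega>"
      using model by (simp add: AE_all_countable)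
    fix K1 K2 :: real assume K: "K1 > 0" "K2 > 0"
    \<comment> \<open>The bias constant plus the stochastic constant; the added 1 makes the sum
      positive.\<close>
    define K where "K = ?q * ?E + ?q * (?F * (?k * K1)) + (2 / c + ?q\<^sup>2) * K2 + 1"
    let ?K1 = "?q * ?E" and ?K2 = "?q * (?F * (?k * K1)) + (2 / c + ?q\<^sup>2) * K2"
    have "?K1 \<ge> 0"
      by (rule mult_nonneg_nonneg[OF nonneg(1,2)])
    moreover have "?K2 \<ge> 0"
      using K nonneg(3) c(1) B by (auto intro!: add_nonneg_nonneg mult_nonneg_nonneg)
    ultimately have "K > 0" "?K1 \<le> K" "?K2 \<le> K" by (simp_all add: K_def)
    \<comment> \<open>For large \<open>T\<close> the allowed covariance error satisfies both size
      conditions of \<open>perturbed_block\<close>, and \<open>\<tau> T\<close> is below 1.\<close>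
    have "\<forall>\<^sub>F T in sequentially. K1 * real T powr (-1/2) < c / 2"
      "\<forall>\<^sub>F T in sequentially. K1 * real T powr (-1/2) < 1"
      "\<forall>\<^sub>F T in sequentially. \<tau> T < 1"
      using c(1) by (intro order_tendstoD(2)[OF T_lim] order_tendstoD(2)[OF tau_lim]; simp)+
    then have "\<forall>\<^sub>F T in sequentially. \<forall>\<omega>\<in>space M.
      (\<forall>t. y (t + int h) \<omega> = (\<alpha>, \<beta>) \<bullet> stack w X t \<omega> + u t \<omega>) \<longrightarrow>
      \<bar>onorm (\<lambda>x. sample_cov_op T (\<lambda>t. stack w X t \<omega>) (\<lambda>t. stack w X t \<omega>) x - cov_op M ?\<Upsilon> ?\<Upsilon> x)\<bar>
        \<le> K1 * real T powr (-1/2) \<longrightarrow>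
      \<bar>norm (sample_cov_vec T (\<lambda>t. u t \<omega>) (\<lambda>t. stack w X t \<omega>))\<bar> \<le> K2 * real T powr (-1/2) \<longrightarrow>
      \<bar>norm (theta_hat h T (\<tau> T) (lhat T \<omega>) (vhat T \<omega>)
             (\<lambda>t. y t \<omega>) (\<lambda>t. w t \<omega>) (\<lambda>t. X t \<omega>) - (\<alpha>, \<beta>))\<bar>
        \<le> K * (real T powr (-1/2) * \<tau> T powr (-1/2 - 2 / \<rho>) + \<tau> T powr ((2 * \<sigma> - 1) / (2 * \<rho>)))"
      using eventually_ge_at_top[of 1]
    proof eventually_elim
      case (elim T)
      show ?case
      proof (intro ballI impI)
        fix \<omega> assume \<omega>: "\<omega> \<in> space M"
          and model: "\<forall>t. y (t + int h) \<omega> = (\<alpha>, \<beta>) \<bullet> stack w X t \<omega> + u t \<omega>"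
          and near: "\<bar>onorm (\<lambda>x. sample_cov_op T (\<lambda>t. stack w X t \<omega>) (\<lambda>t. stack w X t \<omega>) x - cov_op M ?\<Upsilon> ?\<Upsilon> x)\<bar>
            \<le> K1 * real T powr (-1/2)"
          and noise: "\<bar>norm (sample_cov_vec T (\<lambda>t. u t \<omega>) (\<lambda>t. stack w X t \<omega>))\<bar> \<le> K2 * real T powr (-1/2)"
        let ?w = "\<lambda>t. w t \<omega>" and ?X = "\<lambda>t. X t \<omega>"
        let ?H11 = "sample_cov_op T ?w ?w" and ?H12 = "sample_cov_op T ?X ?w"
          and ?H21 = "sample_cov_op T ?w ?X" and ?H22 = "sample_cov_op T ?X ?X"
        let ?e = "sample_cov_vec T (\<lambda>t. u t \<omega>) (\<lambda>t. stack w X t \<omega>)"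
        let ?t = "real T powr (-1/2)" and ?z = "\<tau> T powr (-1/2 - 2 / \<rho>)"
          and ?y = "\<tau> T powr ((2 * \<sigma> - 1) / (2 * \<rho>))"
        have H_block: "sample_cov_op T (\<lambda>t. stack w X t \<omega>) (\<lambda>t. stack w X t \<omega>) = block_op ?H11 ?H12 ?H21 ?H22"
          by (simp add: stack_eq sample_cov_op_Pair)
        interpret perturbed_block ?G11 ?H11 ?G12 ?H12 ?G21 ?H21 ?G22 ?H22 c B "K1 * ?t"
        proof (rule perturbed_block.intro)
          fix z
          let ?D = "\<lambda>x. sample_cov_op T (\<lambda>t. stack w X t \<omega>) (\<lambda>t. stack w X t \<omega>) x - cov_op M ?\<Upsilon> ?\<Upsilon> x"
          have "bounded_linear ?D"
            by (intro bounded_linear_sub bounded_linear_sample_cov_op bounded_linear_cov_op \<Upsilon>)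
          then have "norm (?D z) \<le> onorm ?D * norm z"
            by (rule onorm)
          also have "\<dots> \<le> K1 * ?t * norm z"
            using near by (intro mult_right_mono) auto
          finally show "norm (block_op ?H11 ?H12 ?H21 ?H22 z - block_op ?G11 ?G12 ?G21 ?G22 z) \<le> K1 * ?t * norm z"
            by (simp only: H_block C_block)
        qed (use lin c B bound Gamma11_invertible elim K in
            \<open>auto simp: bounded_linear.linear[OF bounded_linear_sample_cov_op]\<close>)
        have tau: "\<tau> T > 0" using tau_pos elim by simp
        \<comment> \<open>The sample eigenpairs are given only where the sample
          \<open>\<Gamma>11\<close> is invertible, which \<open>bij_H\<close> ensures here.\<close>
        have sd: "spectral_decomposition S' (lhat T \<omega>) (vhat T \<omega>)"
          using spectral_S_hat[OF \<omega> bij_H] by (simp add: sample_schur_def)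
        have "range S' \<subseteq> span (?X ` {1..int T})"
          using range_sample_schur[of T ?w ?X] by (simp only: sample_schur_def)
        then have trunc: "truncated_spectrum S' (lhat T \<omega>) (vhat T \<omega>) (\<tau> T)"
          by (intro truncated_spectrum.intro sd tau finite_spectrum_of_finite_rank[OF sd _ _ tau]) auto
        have obs: "sample_cov_vec T (\<lambda>t. y (t + int h) \<omega>) (\<lambda>t. stack w X t \<omega>)
            = block_op ?H11 ?H12 ?H21 ?H22 (\<alpha>, \<beta>) + ?e"
          unfolding H_block[symmetric] by (rule sample_cov_vec_linear_model) (use model in simp)
        have "norm (theta_hat h T (\<tau> T) (lhat T \<omega>) (vhat T \<omega>) (\<lambda>t. y t \<omega>) ?w ?X - (\<alpha>, \<beta>))
            \<le> ?q * ?E * ?y + (?q * (?F * (?k * (K1 * ?t))) + (2 / c + ?q\<^sup>2) * norm ?e) * ?z"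
          unfolding theta_hat_def stack_def[of w X _ \<omega>, symmetric] obs
          by (rule norm_estimation_error_rate[OF spectral_S[unfolded pop_schur_def] trunc _
                lower g \<rho> lim C(2) sigma]) (use elim C(1) in auto)
        also have "\<dots> \<le> ?q * ?E * ?y + (?q * (?F * (?k * (K1 * ?t))) + (2 / c + ?q\<^sup>2) * (K2 * ?t)) * ?z"
          using noise nonneg(5) by (intro add_left_mono mult_right_mono mult_left_mono) auto
        also have "\<dots> = ?K1 * ?y + ?K2 * (?t * ?z)"
          by (simp only: distrib_left distrib_right mult_ac)
        also have "\<dots> \<le> K * ?y + K * (?t * ?z)"
          using \<open>?K1 \<le> K\<close> \<open>?K2 \<le> K\<close> by (intro add_mono mult_right_mono) auto
        finally show "\<bar>norm (theta_hat h T (\<tau> T) (lhat T \<omega>) (vhat T \<omega>) (\<lambda>t. y t \<omega>) ?w ?X - (\<alpha>, \<beta>))\<bar>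
            \<le> K * (?t * ?z + ?y)"
          by (simp add: distrib_left add.commute)
      qed
    qed
    with \<open>K > 0\<close> show "\<exists>K>0. \<forall>\<^sub>F T in sequentially. \<forall>\<omega>\<in>space M.
      (\<forall>t. y (t + int h) \<omega> = (\<alpha>, \<beta>) \<bullet> stack w X t \<omega> + u t \<omega>) \<longrightarrow>
      \<bar>onorm (\<lambda>x. sample_cov_op T (\<lambda>t. stack w X t \<omega>) (\<lambda>t. stack w X t \<omega>) x - cov_op M ?\<Upsilon> ?\<Upsilon> x)\<bar>
        \<le> K1 * real T powr (-1/2) \<longrightarrow>
      \<bar>norm (sample_cov_vec T (\<lambda>t. u t \<omega>) (\<lambda>t. stack w X t \<omega>))\<bar> \<le> K2 * real T powr (-1/2) \<longrightarrow>
      \<bar>norm (theta_hat h T (\<tau> T) (lhat T \<omega>) (vhat T \<omega>)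
             (\<lambda>t. y t \<omega>) (\<lambda>t. w t \<omega>) (\<lambda>t. X t \<omega>) - (\<alpha>, \<beta>))\<bar>
        \<le> K * (real T powr (-1/2) * \<tau> T powr (-1/2 - 2 / \<rho>) + \<tau> T powr ((2 * \<sigma> - 1) / (2 * \<rho>)))"
      by blast
  qed
qed

end
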